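(* For each $k\in[1,n]$ let $S_k$ be a finite subset of $R$ satisfying Condition (D) in $R$, $\psi_k:S_k\to\mathbb{Z}^+$, $E_k\subseteq S_k$, and put $g_k=\prod_{u\in S_k}(x_k-u)^{\psi_k(u)}$, $h_k=\prod_{u\in E_k}(x_k-u)^{\psi_k(u)}$, so $g_k/h_k=\prod_{u\in S_k\setminus E_k}(x_k-u)^{\psi_k(u)}$. Let $t\in\mathbb{N}$ and $f\in\Omega$. Then: (1) $f\in\bigcap_{m=1}^n\mathcal{I}_t(g_1,\dots,g_{m-1},g_m/h_m,g_{m+1},\dots,g_n)$ if and only if $f(x_1+a_1,\dots,x_n+a_n)_{[\beta]}=0$ for all $a\in(\prod_iS_i)\setminus(\prod_iE_i)$ and all $\beta\in\mathbb{N}^n$ with $\sum_i\lfloor\beta_i/\psi_i(a_i)\rfloor\leqslant t-1$. (2) Suppose $f(x_1+a_1,\dots,x_n+a_n)_{[\beta]}=0$ for all $a\in(\prod_iS_i)\setminus(\prod_iE_i)$ and all $\beta\in\mathbb{N}^n$ with $\sum_i\lfloor\beta_i/\psi_i(a_i)\rfloor\leqslant t-1$. Then there exists a unique $\eta\in\Omega$ such that $f-\eta\in\mathcal{I}_t(g_1,\dots,g_n)$ and for every $\beta\in\mathrm{supp}(\eta)$ and every $\alpha\in\mathbb{N}^n$ with $\sum_i\alpha_i=t$ there exists $k\in[1,n]$ with $\beta_k\leqslant(\sum_{u\in S_k}\psi_k(u))\alpha_k-1$. Moreover, $\mathrm{supp}(\eta)\subseteq\Delta(\mathrm{supp}(f))$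 and $\prod_{k=1}^n(g_k/h_k)$ divides $\eta$. If in addition $t\geqslant1$ and $f(w_1,\dots,w_n)\neq0$ for some $w\in\prod_iS_i$, then for every $m\in[1,n]$, $$\deg(f)\geqslant\deg(\eta)\geqslant(t-1)\sum_{u\in S_m\setminus E_m}\psi_m(u)+\sum_{k=1}^n\sum_{u\in S_k\setminus E_k}\psi_k(u).$$
   Context: Let $R$ be a commutative ring with identity $1_R$, $n$ a positive integer, $[1,n]=\{1,\dots,n\}$, $\mathbb{N}=\{0,1,2,\dots\}$, $\Omega=R[x_1,\dots,x_n]$, $\deg$ total degree. For $\alpha,\beta\in\mathbb{N}^n$, $\alpha\leqslant\beta$ means $\alpha_i\leqslant\beta_i$ for all $i$. For $f\in\Omega$, $f_{[\alpha]}$ is the coefficient of $x_1^{\alpha_1}\cdots x_n^{\alpha_n}$ and $\mathrm{supp}(f)=\{\alpha:f_{[\alpha]}\neq0\}$; $\Delta(A)=\{\beta:\exists\alpha\in A,\beta\leqslant\alpha\}$ for $A\subseteq\mathbb{N}^n$. For polynomials $q_1,\dots,q_n$ with $q_k\in R[x_k]$ monic (leading coefficient $1_R$) and $t\in\mathbb{N}$, $\mathcal{I}_t(q_1,\dots,q_n)$ denotes the ideal of $\Omega$ generated by $\{\prod_{k=1}^nq_k^{\alpha_k}:\alpha\in\mathbb{N}^n,\sum_i\alpha_i=t\}$. A subset $X\subseteq R$ satisfies Condition (D) in $R$ if for all $a\neq b$ in $X$, $b-a$ is not a zero divisor of $R$. *)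

theory Defs
  imports Complex_Main "HOL-Library.FuncSet" "HOL-Library.Poly_Mapping" "HOL-Library.Extended_Real"
begin

text \<open>
  The variables \<open>x\<^sub>1, \<dots>, x\<^sub>n\<close> are indexed by an arbitrary nonempty finite type \<open>'n\<close>, so
  \<open>n = CARD('n)\<close>. Exponent vectors are elements of \<open>'n \<Rightarrow>\<^sub>0 nat\<close>. In the polynomial type
  below, \<open>lookup f \<alpha>\<close> is the coefficient of \<open>f\<close> at \<open>\<alpha>\<close>, and \<open>keys f\<close> is the support of \<open>f\<close>.
\<close>

type_synonym ('n, 'r) mpoly = "('n \<Rightarrow>\<^sub>0 nat) \<Rightarrow>\<^sub>0 'r"

definition Const :: "'r \<Rightarrow> ('n, 'r::comm_ring_1) mpoly"
  where "Const c = Poly_Mapping.single 0 c"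

definition Var :: "'n \<Rightarrow> ('n, 'r::comm_ring_1) mpoly"
  where "Var k = Poly_Mapping.single (Poly_Mapping.single k 1) 1"

text \<open>Substitution of \<open>y k\<close> for the \<open>k\<close>-th variable, the coefficients being mapped by \<open>c\<close>.\<close>

definition subst_mpoly ::
    "('r \<Rightarrow> 's) \<Rightarrow> ('n \<Rightarrow> 's) \<Rightarrow> ('n::finite, 'r::comm_ring_1) mpoly \<Rightarrow> 's::comm_ring_1"
  where "subst_mpoly c y f =
    (\<Sum>\<alpha>\<in>Poly_Mapping.keys f. c (Poly_Mapping.lookup f \<alpha>) * (\<Prod>k\<in>UNIV. y k ^ Poly_Mapping.lookup \<alpha> k))"

definition eval_mpoly :: "('n \<Rightarrow> 'r) \<Rightarrow> ('n::finite, 'r::comm_ring_1) mpoly \<Rightarrow> 'r"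
  where "eval_mpoly w f = subst_mpoly (\<lambda>c. c) w f"

definition translate :: "('n \<Rightarrow> 'r) \<Rightarrow> ('n::finite, 'r::comm_ring_1) mpoly \<Rightarrow> ('n, 'r) mpoly"
  where "translate a f = subst_mpoly Const (\<lambda>k. Var k + Const (a k)) f"

definition weight :: "('n::finite \<Rightarrow>\<^sub>0 nat) \<Rightarrow> nat"
  where "weight \<alpha> = (\<Sum>k\<in>UNIV. Poly_Mapping.lookup \<alpha> k)"

text \<open>The total degree is extended-real valued, so that the zero polynomial has degree \<open>-\<infinity>\<close>.\<close>

definition total_deg :: "('n::finite, 'r::comm_ring_1) mpoly \<Rightarrow> ereal"
  where "total_deg f = (SUP \<alpha>\<in>Poly_Mapping.keys f. ereal (real (weight \<alpha>)))"

definition down_closure :: "('n \<Rightarrow>\<^sub>0 nat) set \<Rightarrow> ('n \<Rightarrow>\<^sub>0 nat) set"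
  where "down_closure A =
    {\<beta>. \<exists>\<alpha>\<in>A. \<forall>k. Poly_Mapping.lookup \<beta> k \<le> Poly_Mapping.lookup \<alpha> k}"

text \<open>
  The ideal generated by a set is its span in the ring, regarded as a module over itself.
\<close>

lemma module_mult: "module ((*) :: 'a::comm_ring_1 \<Rightarrow> 'a \<Rightarrow> 'a)"
  by unfold_locales (simp_all add: algebra_simps)

definition ideal_gen :: "'a::comm_ring_1 set \<Rightarrow> 'a set"
  where "ideal_gen A = module.span (*) A"

definition power_ideal ::
    "nat \<Rightarrow> ('n \<Rightarrow> ('n::finite, 'r::comm_ring_1) mpoly) \<Rightarrow> ('n, 'r) mpoly set"
  where "power_ideal t q =
    ideal_gen {\<Prod>k\<in>UNIV. q k ^ Poly_Mapping.lookup \<alpha> k |\<alpha>. weight \<alpha> = t}"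

definition zero_divisor :: "'r::comm_ring_1 \<Rightarrow> bool"
  where "zero_divisor x \<longleftrightarrow> (\<exists>c. c \<noteq> 0 \<and> x * c = 0)"

definition condition_D :: "'r::comm_ring_1 set \<Rightarrow> bool"
  where "condition_D X \<longleftrightarrow> (\<forall>a\<in>X. \<forall>b\<in>X. a \<noteq> b \<longrightarrow> \<not> zero_divisor (b - a))"

definition root_prod ::
    "('n \<Rightarrow> 'r \<Rightarrow> nat) \<Rightarrow> ('n \<Rightarrow> 'r set) \<Rightarrow> 'n \<Rightarrow> ('n, 'r::comm_ring_1) mpoly"
  where "root_prod \<psi> T k = (\<Prod>u\<in>T k. (Var k - Const u) ^ \<psi> k u)"

text \<open>
  With \<open>g\<^sub>k = root_prod \<psi> S k\<close> and \<open>h\<^sub>k = root_prod \<psi> E k\<close>, the quotient \<open>g\<^sub>k / h\<^sub>k\<close> is the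
  product over \<open>S k - E k\<close>.
\<close>

lemma root_prod_quotient:
  assumes "finite (S k)" and "E k \<subseteq> S k"
  shows "root_prod \<psi> S k = root_prod \<psi> (\<lambda>i. S i - E i) k * root_prod \<psi> E k"
  unfolding root_prod_def using assms by (rule prod.subset_diff[rotated])

definition vanishing_cond ::
    "('n \<Rightarrow> 'r set) \<Rightarrow> ('n \<Rightarrow> 'r set) \<Rightarrow> ('n \<Rightarrow> 'r \<Rightarrow> nat) \<Rightarrow> nat
      \<Rightarrow> ('n::finite, 'r::comm_ring_1) mpoly \<Rightarrow> bool"
  where "vanishing_cond S E \<psi> t f \<longleftrightarrow>
    (\<forall>a\<in>Pi UNIV S - Pi UNIV E. \<forall>\<beta> :: 'n \<Rightarrow>\<^sub>0 nat.
       int (\<Sum>i\<in>UNIV. Poly_Mapping.lookup \<beta> i div \<psi> i (a i)) \<le> int t - 1 \<longrightarrow>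
       Poly_Mapping.lookup (translate a f) \<beta> = 0)"

text \<open>
  The condition on the remainder \<open>\<eta>\<close>, where \<open>d k\<close> is the degree of the \<open>k\<close>-th divisor. The
  comparison is made in the integers, as \<open>d k * \<alpha>\<^sub>k\<close> may be \<open>0\<close>.
\<close>

definition reduced ::
    "nat \<Rightarrow> ('n \<Rightarrow> nat) \<Rightarrow> ('n::finite, 'r::comm_ring_1) mpoly \<Rightarrow> bool"
  where "reduced t d \<eta> \<longleftrightarrow>
    (\<forall>\<beta>\<in>Poly_Mapping.keys \<eta>. \<forall>\<alpha> :: 'n \<Rightarrow>\<^sub>0 nat. weight \<alpha> = t \<longrightarrow>
       (\<exists>k. int (Poly_Mapping.lookup \<beta> k) \<le> int (d k * Poly_Mapping.lookup \<alpha> k) - 1))"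

end

theory Submission
  imports Defs
begin

text \<open>
  The central tool is a multivariate Newton basis whose nodes, in each variable \<open>x\<^sub>k\<close>, run
  cyclically through the points of \<open>S\<^sub>k\<close> repeated according to multiplicity, so that \<open>g\<^sub>k\<close>
  recurs as a factor after each round. The basis element with exponent \<open>\<beta>\<close> has \<open>x\<^sup>\<beta>\<close> as its
  largest monomial. Let \<open>a\<^sub>k\<close> be the node following the first \<open>\<beta>\<^sub>k\<close> ones and \<open>\<gamma>\<^sub>k\<close> the number
  of its earlier occurrences. The \<open>\<gamma>\<close>-th Taylor coefficient at \<open>a\<close> then vanishes on every basis
  element whose exponent is not below \<open>\<beta>\<close>, and takes the value of a non zero divisor at \<open>\<beta>\<close> by
  Condition (D). Vanishing conditions therefore eliminate Newton coefficients one by one, over any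
  commutative ring. The remainder \<open>\<eta>\<close> is the part of the expansion with exponents that are not
  leading exponents of the ideal.

  Listing the points of \<open>S\<^sub>k - E\<^sub>k\<close> first makes all surviving basis elements of \<open>\<eta>\<close> divisible
  by the product of the \<open>g\<^sub>k / h\<^sub>k\<close>. A different choice of nodes gives the degree bound.
\<close>

abbreviation lookup :: "('a \<Rightarrow>\<^sub>0 'b::zero) \<Rightarrow> 'a \<Rightarrow> 'b"
  where "lookup \<equiv> Poly_Mapping.lookup"

abbreviation keys :: "('a \<Rightarrow>\<^sub>0 'b::zero) \<Rightarrow> 'a set"
  where "keys \<equiv> Poly_Mapping.keys"

section \<open>Exponent vectors\<close>

definition le_exp :: "('n \<Rightarrow>\<^sub>0 nat) \<Rightarrow> ('n \<Rightarrow>\<^sub>0 nat) \<Rightarrow> bool"  (infix \<open>\<preceq>\<close> 50)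
  where "\<alpha> \<preceq> \<beta> \<longleftrightarrow> (\<forall>k. lookup \<alpha> k \<le> lookup \<beta> k)"

definition exp_of :: "('n::finite \<Rightarrow> nat) \<Rightarrow> ('n \<Rightarrow>\<^sub>0 nat)"
  where "exp_of v = Abs_poly_mapping v"

lemma lookup_exp_of [simp]: "lookup (exp_of v) k = v k"
  by (simp add: exp_of_def)

lemma le_exp_refl [simp]: "\<alpha> \<preceq> \<alpha>"
  by (simp add: le_exp_def)

lemma le_exp_trans: "\<alpha> \<preceq> \<beta> \<Longrightarrow> \<beta> \<preceq> \<gamma> \<Longrightarrow> \<alpha> \<preceq> \<gamma>"
  unfolding le_exp_def using order_trans by blast

lemma le_exp_antisym: "\<alpha> \<preceq> \<beta> \<Longrightarrow> \<beta> \<preceq> \<alpha> \<Longrightarrow> \<alpha> = \<beta>"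
  by (rule poly_mapping_eqI) (auto simp: le_exp_def intro: le_antisym)

lemma le_exp_add [simp]: "\<alpha> \<preceq> \<alpha> + \<beta>" "\<alpha> \<preceq> \<beta> + \<alpha>"
  by (simp_all add: le_exp_def lookup_add)

lemma le_exp_add_cancel [simp]: "\<alpha> + \<gamma> \<preceq> \<beta> + \<gamma> \<longleftrightarrow> \<alpha> \<preceq> \<beta>"
  by (simp add: le_exp_def lookup_add)

lemma le_exp_add_diff: "\<alpha> \<preceq> \<beta> \<Longrightarrow> \<beta> - \<alpha> + \<alpha> = \<beta>"
  by (rule poly_mapping_eqI) (simp add: lookup_add lookup_minus le_exp_def)

lemma weight_zero [simp]: "weight 0 = 0"
  by (simp add: weight_def)

lemma weight_add: "weight (\<alpha> + \<beta>) = weight \<alpha> + weight \<beta>"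
  by (simp add: weight_def lookup_add sum.distrib)

lemma weight_exp_of [simp]: "weight (exp_of v) = (\<Sum>k\<in>UNIV. v k)"
  by (simp add: weight_def)

lemma weight_single [simp]: "weight (Poly_Mapping.single k i) = i"
  by (simp add: weight_def lookup_single when_def)

lemma weight_mono: "\<alpha> \<preceq> \<beta> \<Longrightarrow> weight \<alpha> \<le> weight \<beta>"
  unfolding weight_def le_exp_def by (auto intro: sum_mono)

lemma weight_less:
  assumes "\<alpha> \<preceq> \<beta>" "\<alpha> \<noteq> \<beta>"
  shows "weight \<alpha> < weight \<beta>"
proof -
  have *: "lookup \<alpha> k \<le> lookup \<beta> k" for k
    using assms by (simp add: le_exp_def)
  moreover obtain k where "lookup \<alpha> k \<noteq> lookup \<beta> k"
    using assms(2) by (metis poly_mapping_eqI)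
  ultimately have "\<exists>k\<in>UNIV. lookup \<alpha> k < lookup \<beta> k"
    by (metis UNIV_I le_neq_implies_less)
  then show ?thesis
    unfolding weight_def using * by (intro sum_strict_mono_ex1) auto
qed

text \<open>Raising one coordinate by one appends a single node to a Newton product, so this
  induction fits the Newton basis.\<close>

lemma exp_induct [case_names zero add]:
  fixes \<beta> :: "'n::finite \<Rightarrow>\<^sub>0 nat"
  assumes "P 0" and "\<And>\<beta> k. P \<beta> \<Longrightarrow> P (\<beta> + Poly_Mapping.single k 1)"
  shows "P \<beta>"
proof (induction "weight \<beta>" arbitrary: \<beta> rule: less_induct)
  case less
  show ?case
  proof (cases "\<beta> = 0")
    case False
    then obtain k where k: "lookup \<beta> k \<noteq> 0"
      by (metis poly_mapping_eqI lookup_zero)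
    let ?e = "Poly_Mapping.single k (1::nat)"
    have eq: "\<beta> - ?e + ?e = \<beta>"
      using k by (intro le_exp_add_diff) (auto simp: le_exp_def lookup_single when_def)
    then have "weight (\<beta> - ?e) < weight \<beta>"
      by (metis less_add_one weight_add weight_single)
    then show ?thesis
      using less eq assms(2) by metis
  qed (use assms in simp)
qed

text \<open>Greedy choice: as long as the weight is below the sum of the bounds, some coordinate is
  below its own bound and can be raised by one.\<close>

lemma exists_exp_le_weight:
  assumes "t \<le> (\<Sum>k\<in>UNIV. v k)"
  shows "\<exists>\<alpha>::'n::finite \<Rightarrow>\<^sub>0 nat. weight \<alpha> = t \<and> (\<forall>k. lookup \<alpha> k \<le> v k)"
  using assms
proof (induction t)
  case 0
  show ?case by (rule exI[of _ 0]) simp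
next
  case (Suc t)
  then obtain \<alpha> :: "'n \<Rightarrow>\<^sub>0 nat" where \<alpha>: "weight \<alpha> = t" "\<And>k. lookup \<alpha> k \<le> v k"
    by auto
  have "\<exists>k. lookup \<alpha> k < v k"
  proof (rule ccontr)
    assume "\<nexists>k. lookup \<alpha> k < v k"
    then have "(\<Sum>k\<in>UNIV. v k) \<le> weight \<alpha>"
      unfolding weight_def by (intro sum_mono) (auto simp: not_less)
    then show False using \<alpha> Suc.prems by simp
  qed
  then obtain k where k: "lookup \<alpha> k < v k" by blast
  let ?\<beta> = "\<alpha> + Poly_Mapping.single k 1"
  have "weight ?\<beta> = Suc t"
    by (simp add: weight_add \<alpha>)
  moreover have "lookup ?\<beta> i \<le> v i" for i
    using k \<alpha>(2)[of i] by (auto simp: lookup_add lookup_single when_def)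
  ultimately show ?case by blast
qed

lemma down_closure_iff: "\<beta> \<in> down_closure A \<longleftrightarrow> (\<exists>\<alpha>\<in>A. \<beta> \<preceq> \<alpha>)"
  by (auto simp: down_closure_def le_exp_def)

section \<open>Polynomials\<close>

lemma Const_zero [simp]: "Const 0 = 0"
  and Const_one [simp]: "Const 1 = 1"
  and Const_add: "Const (a + b) = Const a + Const b"
  and Const_diff: "Const (a - b) = Const a - Const b"
  and Const_mult: "Const (a * b) = Const a * Const b"
  by (simp_all add: Const_def single_add single_diff mult_single)

lemma poly_mapping_sum_single:
  "(\<Sum>\<alpha>\<in>keys f. Poly_Mapping.single \<alpha> (lookup f \<alpha>)) = f"
  by (rule poly_mapping_eqI)
     (auto simp: lookup_sum lookup_single when_def in_keys_iff)

lemma mpoly_induct [case_names single add]: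
  fixes f :: "('n, 'r::comm_ring_1) mpoly"
  assumes "\<And>\<alpha> c. P (Poly_Mapping.single \<alpha> c)" and "\<And>f g. P f \<Longrightarrow> P g \<Longrightarrow> P (f + g)"
  shows "P f"
proof -
  have "P (\<Sum>\<alpha>\<in>A. Poly_Mapping.single \<alpha> (lookup f \<alpha>))" if "finite A" for A
    using that
  proof (induction A rule: finite_induct)
    case empty
    show ?case using assms(1)[of 0 0] by simp
  qed (use assms in simp)
  then show ?thesis
    using poly_mapping_sum_single[of f] by (metis finite_keys)
qed

lemma lookup_single_mult_add:
  fixes g :: "('n, 'r::comm_ring_1) mpoly"
  shows "lookup (Poly_Mapping.single \<mu> c * g) (\<mu> + \<gamma>) = c * lookup g \<gamma>"
  by (induction g rule: mpoly_induct)
     (auto simp: mult_single lookup_single when_def ring_distribs lookup_add)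

lemma lookup_single_mult_self:
  fixes g :: "('n, 'r::comm_ring_1) mpoly"
  shows "lookup (Poly_Mapping.single \<mu> c * g) \<mu> = c * lookup g 0"
  using lookup_single_mult_add[of \<mu> c g 0] by simp

lemma lookup_Const_mult: "lookup (Const c * f) \<gamma> = c * lookup f \<gamma>"
  using lookup_single_mult_add[of 0 c f \<gamma>] by (simp add: Const_def)

lemma keys_Const_mult: "keys (Const c * f) \<subseteq> keys f"
  by (auto simp: in_keys_iff lookup_Const_mult)

lemma keys_single_mult: "\<gamma> \<in> keys (Poly_Mapping.single \<mu> c * g) \<Longrightarrow> \<mu> \<preceq> \<gamma>"
  using keys_mult[of "Poly_Mapping.single \<mu> c" g] by (auto split: if_splits)

text \<open>The zero exponent is a sum of two exponents only as 0 + 0.\<close>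

lemma lookup_mult_zero:
  fixes f g :: "('n, 'r::comm_ring_1) mpoly"
  shows "lookup (f * g) 0 = lookup f 0 * lookup g 0"
proof (induction f rule: mpoly_induct)
  case (single \<alpha> c)
  show ?case
  proof (cases "\<alpha> = 0")
    case True
    then show ?thesis using lookup_Const_mult[of c g 0] by (simp add: Const_def)
  next
    case False
    then have "\<not> \<alpha> \<preceq> 0"
      using le_exp_add(1)[of 0 \<alpha>] by (auto dest: le_exp_antisym)
    then show ?thesis
      using keys_single_mult[of 0 \<alpha> c g] False
      by (auto simp: in_keys_iff lookup_single when_def)
  qed
qed (simp add: ring_distribs lookup_add)

lemma lookup_prod_zero:
  fixes f :: "'a \<Rightarrow> ('n, 'r::comm_ring_1) mpoly"
  shows "lookup (\<Prod>i\<in>A. f i) 0 = (\<Prod>i\<in>A. lookup (f i) 0)"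
  by (induction A rule: infinite_finite_induct) (simp_all add: lookup_mult_zero)

lemma lookup_Var_zero [simp]: "lookup (Var k) 0 = 0"
  by (auto simp: Var_def lookup_single when_def dest: arg_cong[where f = "\<lambda>\<alpha>. lookup \<alpha> k"])

lemma lookup_Const_zero [simp]: "lookup (Const c) 0 = c"
  by (simp add: Const_def)

lemma Var_power: "Var k ^ j = Poly_Mapping.single (Poly_Mapping.single k j) 1"
  by (induction j) (simp_all add: Var_def mult_single flip: single_add)

lemma prod_single_one:
  "(\<Prod>k\<in>A. Poly_Mapping.single (\<mu> k) (1::'r::comm_ring_1)) = Poly_Mapping.single (\<Sum>k\<in>A. \<mu> k) 1"
  by (induction A rule: infinite_finite_induct) (simp_all add: mult_single)

lemma sum_single_exp: "(\<Sum>k\<in>UNIV. Poly_Mapping.single k (lookup \<alpha> k)) = (\<alpha>::'n::finite \<Rightarrow>\<^sub>0 nat)"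
  by (rule poly_mapping_eqI) (simp add: lookup_sum lookup_single when_def)

lemma prod_Var_power:
  "(\<Prod>k\<in>UNIV. Var k ^ lookup \<alpha> k) = Poly_Mapping.single (\<alpha>::'n::finite \<Rightarrow>\<^sub>0 nat) (1::'r::comm_ring_1)"
  by (simp add: Var_power prod_single_one sum_single_exp)

section \<open>Substitution\<close>

lemma subst_mpoly_add:
  fixes f g :: "('n::finite, 'r::comm_ring_1) mpoly" and c :: "'r \<Rightarrow> 's::comm_ring_1"
  assumes "c 0 = 0" "\<And>a b. c (a + b) = c a + c b"
  shows "subst_mpoly c y (f + g) = subst_mpoly c y f + subst_mpoly c y g"
  unfolding subst_mpoly_def
  by (rule setsum_keys_plus_distrib) (simp_all add: assms ring_distribs)

lemma subst_mpoly_single: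
  assumes "c 0 = 0"
  shows "subst_mpoly c y (Poly_Mapping.single \<alpha> a) = c a * (\<Prod>k\<in>UNIV. y k ^ lookup \<alpha> k)"
  unfolding subst_mpoly_def by (simp add: assms)

lemma subst_mpoly_mult:
  fixes f g :: "('n::finite, 'r::comm_ring_1) mpoly" and c :: "'r \<Rightarrow> 's::comm_ring_1"
  assumes "c 0 = 0" "\<And>a b. c (a + b) = c a + c b" "\<And>a b. c (a * b) = c a * c b"
  shows "subst_mpoly c y (f * g) = subst_mpoly c y f * subst_mpoly c y g"
proof (induction f rule: mpoly_induct)
  case (single \<alpha> a)
  show ?case
  proof (induction g rule: mpoly_induct)
    case (single \<beta> b)
    show ?case
      using assms by (simp add: mult_single subst_mpoly_single lookup_add power_add
        prod.distrib algebra_simps)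
  qed (use assms in \<open>simp add: ring_distribs subst_mpoly_add\<close>)
qed (use assms in \<open>simp add: ring_distribs subst_mpoly_add\<close>)

lemma translate_add: "translate a (f + g) = translate a f + translate a g"
  unfolding translate_def by (rule subst_mpoly_add) (simp_all add: Const_add)

lemma translate_mult: "translate a (f * g) = translate a f * translate a g"
  unfolding translate_def by (rule subst_mpoly_mult) (simp_all add: Const_add Const_mult)

lemma translate_Const [simp]: "translate a (Const c) = Const c"
  unfolding translate_def by (simp add: Const_def[of c] subst_mpoly_single)

lemma translate_zero [simp]: "translate a 0 = 0"
  using translate_Const[of a 0] by simp

lemma translate_one [simp]: "translate a 1 = 1"
  using translate_Const[of a 1] by simp

lemma translate_diff: "translate a (f - g) = translate a f - translate a g"
  using translate_add[of a "f - g" g] by (simp add: algebra_simps)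

lemma translate_Var [simp]: "translate a (Var k) = Var k + Const (a k)"
proof -
  have *: "(\<Prod>i\<in>UNIV. (Var i + Const (a i)) ^ (1 when k = i)) = Var k + Const (a k)"
    using prod.mono_neutral_right[of UNIV "{k}" "\<lambda>i. (Var i + Const (a i)) ^ (1 when k = i)"]
    by (simp add: when_def)
  then show ?thesis
    unfolding translate_def Var_def[of k]
    by (subst subst_mpoly_single) (simp_all add: lookup_single Var_def[of k])
qed

lemma translate_prod: "translate a (\<Prod>i\<in>A. f i) = (\<Prod>i\<in>A. translate a (f i))"
  by (induction A rule: infinite_finite_induct) (simp_all add: translate_mult)

lemma translate_sum: "translate a (\<Sum>i\<in>A. f i) = (\<Sum>i\<in>A. translate a (f i))"
  by (induction A rule: infinite_finite_induct) (simp_all add: translate_add)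

lemma translate_power: "translate a (f ^ j) = translate a f ^ j"
  by (induction j) (simp_all add: translate_mult)

text \<open>The constant term is multiplicative and sends x_k + w_k to w_k. Values on the grid thus
  become Taylor coefficients, which the vanishing condition can address.\<close>

lemma eval_mpoly_eq: "eval_mpoly w f = lookup (translate w f) 0"
proof (induction f rule: mpoly_induct)
  case (single \<alpha> c)
  have power: "lookup (p ^ j) 0 = lookup p 0 ^ j" for p :: "('b, 'a) mpoly" and j
    using lookup_prod_zero[of "\<lambda>_. p" "{..<j}"] by simp
  show ?case
    unfolding eval_mpoly_def translate_def
    by (simp add: subst_mpoly_single lookup_mult_zero lookup_prod_zero power lookup_add)
next
  case (add f g)
  then show ?case
    by (simp add: eval_mpoly_def subst_mpoly_add translate_add lookup_add)
qed

section \<open>Newton bases\<close>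

text \<open>Each variable \<open>k\<close> carries a sequence \<open>V k\<close> of nodes, possibly with repetitions.\<close>

definition newton_basis ::
    "('n::finite \<Rightarrow> nat \<Rightarrow> 'r) \<Rightarrow> ('n \<Rightarrow>\<^sub>0 nat) \<Rightarrow> ('n, 'r::comm_ring_1) mpoly"
  where "newton_basis V \<beta> = (\<Prod>k\<in>UNIV. \<Prod>i<lookup \<beta> k. Var k - Const (V k i))"

text \<open>\<open>c\<close> is a finitely supported family of coefficients; giving it the type of
  polynomials lets scaling and index shifts be written as multiplication.\<close>

definition newton ::
    "('n::finite \<Rightarrow> nat \<Rightarrow> 'r) \<Rightarrow> ('n, 'r::comm_ring_1) mpoly \<Rightarrow> ('n, 'r) mpoly"
  where "newton V c = (\<Sum>\<beta>\<in>keys c. Const (lookup c \<beta>) * newton_basis V \<beta>)"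

lemma newton_basis_zero [simp]: "newton_basis V 0 = 1"
  by (simp add: newton_basis_def)

lemma prod_lessThan_add:
  fixes f :: "nat \<Rightarrow> 'a::comm_monoid_mult"
  shows "(\<Prod>i<a + b. f i) = (\<Prod>i<a. f i) * (\<Prod>i<b. f (a + i))"
  by (induction b) (simp_all add: mult.assoc)

lemma newton_basis_add:
  "newton_basis V (\<beta> + \<gamma>) = newton_basis V \<beta> * newton_basis (\<lambda>k i. V k (lookup \<beta> k + i)) \<gamma>"
  by (simp add: newton_basis_def lookup_add prod_lessThan_add prod.distrib)

lemma newton_basis_single [simp]:
  "newton_basis V (Poly_Mapping.single k 1) = Var k - Const (V k 0)"
proof -
  have "newton_basis V (Poly_Mapping.single k 1)
      = (\<Prod>i\<in>UNIV. if i = k then Var k - Const (V k 0) else 1)"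
    unfolding newton_basis_def by (rule prod.cong) (auto simp: lookup_single when_def)
  then show ?thesis by simp
qed

lemma newton_basis_add_single:
  "newton_basis V (\<beta> + Poly_Mapping.single k 1)
    = newton_basis V \<beta> * (Var k - Const (V k (lookup \<beta> k)))"
  by (subst newton_basis_add, subst newton_basis_single) simp

lemma newton_add: "newton V (c + d) = newton V c + newton V d"
  unfolding newton_def
  by (rule setsum_keys_plus_distrib) (simp_all add: Const_add ring_distribs)

lemma newton_zero [simp]: "newton V 0 = 0"
  by (simp add: newton_def)

lemma newton_diff: "newton V (c - d) = newton V c - newton V d"
  using newton_add[of V "c - d" d] by (simp add: algebra_simps)

lemma newton_single: "newton V (Poly_Mapping.single \<beta> a) = Const a * newton_basis V \<beta>"
  by (simp add: newton_def)

lemma newton_Const_mult: "newton V (Const a * c) = Const a * newton V c"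
  by (induction c rule: mpoly_induct)
     (simp_all add: newton_add newton_single ring_distribs Const_def mult_single flip: mult.assoc)

text \<open>Each appended linear factor adds 0 or 1 to the exponent of its own variable. With the
  leading coefficient 1, the change of basis from monomials is unitriangular for
  \<open>\<preceq>\<close>.\<close>

lemma keys_newton_basis: "\<gamma> \<in> keys (newton_basis V \<beta>) \<Longrightarrow> \<gamma> \<preceq> \<beta>"
proof (induction \<beta> arbitrary: \<gamma> rule: exp_induct)
  case zero
  then show ?case by simp
next
  case (add \<beta> k)
  let ?e = "Poly_Mapping.single k (1::nat)"
  have "keys (Var k - Const (V k (lookup \<beta> k))) \<subseteq> {?e, 0}"
    by (auto simp: in_keys_iff lookup_minus Var_def Const_def lookup_single when_def split: if_splits)
  then obtain \<alpha> \<delta> where "\<gamma> = \<alpha> + \<delta>" "\<alpha> \<in> keys (newton_basis V \<beta>)" "\<delta> \<in> {?e, 0}"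
    using add.prems keys_mult[of "newton_basis V \<beta>"]
    unfolding newton_basis_add_single by blast
  moreover have "\<delta> \<preceq> ?e"
    using \<open>\<delta> \<in> {?e, 0}\<close> by (auto simp: le_exp_def)
  ultimately show ?case
    using add.IH[of \<alpha>] by (auto simp: le_exp_def lookup_add intro: add_mono)
qed

lemma lookup_newton_basis_self: "lookup (newton_basis V \<beta>) \<beta> = 1"
proof (induction \<beta> rule: exp_induct)
  case (add \<beta> k)
  let ?e = "Poly_Mapping.single k (1::nat)" and ?N = "newton_basis V \<beta>"
  have "\<not> \<beta> + ?e \<preceq> \<beta>"
    by (auto simp: le_exp_def lookup_add intro!: exI[of _ k])
  then have "lookup ?N (?e + \<beta>) = 0"
    using keys_newton_basis[of "\<beta> + ?e" V \<beta>] by (auto simp: in_keys_iff add.commute)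
  moreover have "lookup (Var k * ?N) (?e + \<beta>) = 1"
    using add lookup_single_mult_add[of ?e 1 ?N \<beta>] by (simp add: Var_def)
  moreover have "newton_basis V (\<beta> + ?e) = Var k * ?N - Const (V k (lookup \<beta> k)) * ?N"
    by (simp only: newton_basis_add_single) (simp add: algebra_simps)
  ultimately show ?case
    by (simp add: lookup_minus lookup_Const_mult add.commute)
qed simp

lemma keys_newton:
  assumes "\<gamma> \<in> keys (newton V c)"
  shows "\<exists>\<beta>\<in>keys c. \<gamma> \<preceq> \<beta>"
proof -
  obtain \<beta> where \<beta>: "\<beta> \<in> keys c" "\<gamma> \<in> keys (Const (lookup c \<beta>) * newton_basis V \<beta>)"
    using assms subsetD[OF keys_sum] unfolding newton_def by force
  then show ?thesis
    using subsetD[OF keys_Const_mult] keys_newton_basis by metis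
qed

text \<open>Only basis elements indexed above \<beta> can contain its monomial; when \<beta> is
  maximal, just its own monic term remains.\<close>

lemma lookup_newton_maximal:
  assumes "\<And>\<beta>'. \<beta>' \<in> keys c \<Longrightarrow> \<beta> \<preceq> \<beta>' \<Longrightarrow> \<beta>' = \<beta>"
  shows "lookup (newton V c) \<beta> = lookup c \<beta>"
proof -
  have "lookup (newton_basis V \<beta>') \<beta> = (1 when \<beta>' = \<beta>)" if "\<beta>' \<in> keys c" for \<beta>'
    using assms[OF that] keys_newton_basis[of \<beta> V \<beta>']
    by (auto simp: lookup_newton_basis_self when_def in_keys_iff)
  then have "lookup (newton V c) \<beta> = (\<Sum>\<beta>'\<in>keys c. lookup c \<beta>' * (1 when \<beta>' = \<beta>))"
    by (simp add: newton_def lookup_sum lookup_Const_mult)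
  then show ?thesis
    by (simp add: when_def in_keys_iff if_distrib cong: if_cong split: if_splits)
qed

text \<open>A support index of maximal weight is maximal for \<open>\<preceq>\<close>, so its
  coefficient survives in the polynomial without cancellation.\<close>

lemma total_deg_newton_ge:
  assumes "\<beta> \<in> keys c"
  shows "total_deg (newton V c) \<ge> ereal (real (weight \<beta>))"
proof -
  have "Max (weight ` keys c) \<in> weight ` keys c"
    using assms by (intro Max_in) auto
  then obtain \<beta>0 where \<beta>0: "\<beta>0 \<in> keys c" "Max (weight ` keys c) = weight \<beta>0"
    by auto
  have max: "weight \<beta>' \<le> weight \<beta>0" if "\<beta>' \<in> keys c" for \<beta>'
    using that by (simp flip: \<beta>0(2))
  have "\<beta>' = \<beta>0" if "\<beta>' \<in> keys c" "\<beta>0 \<preceq> \<beta>'" for \<beta>'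
    using max[OF that(1)] weight_less[OF that(2)] by force
  then have "lookup (newton V c) \<beta>0 = lookup c \<beta>0"
    by (rule lookup_newton_maximal)
  then have "\<beta>0 \<in> keys (newton V c)"
    using \<beta>0 by (simp add: in_keys_iff)
  then have "ereal (real (weight \<beta>0)) \<le> total_deg (newton V c)"
    unfolding total_deg_def by (rule SUP_upper)
  then show ?thesis
    using max[OF assms] by (meson ereal_less_eq(3) of_nat_mono order_trans)
qed

section \<open>Spans of Newton basis elements and expansion of arbitrary polynomials\<close>

definition newton_span ::
    "('n::finite \<Rightarrow> nat \<Rightarrow> 'r) \<Rightarrow> ('n \<Rightarrow>\<^sub>0 nat) set \<Rightarrow> ('n, 'r::comm_ring_1) mpoly set"
  where "newton_span V A = newton V ` {c. keys c \<subseteq> A}"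

lemma newton_span_add: "f \<in> newton_span V A \<Longrightarrow> g \<in> newton_span V A \<Longrightarrow> f + g \<in> newton_span V A"
proof -
  assume "f \<in> newton_span V A" "g \<in> newton_span V A"
  then obtain c d where "f = newton V c" "keys c \<subseteq> A" "g = newton V d" "keys d \<subseteq> A"
    unfolding newton_span_def by blast
  then show ?thesis
    unfolding newton_span_def using keys_add[of c d]
    by (intro image_eqI[of _ _ "c + d"]) (auto simp: newton_add)
qed

lemma newton_span_Const_mult: "f \<in> newton_span V A \<Longrightarrow> Const a * f \<in> newton_span V A"
proof -
  assume "f \<in> newton_span V A"
  then obtain c where "f = newton V c" "keys c \<subseteq> A"
    unfolding newton_span_def by blast
  then show ?thesis
    unfolding newton_span_def using keys_Const_mult[of a c]
    by (intro image_eqI[of _ _ "Const a * c"]) (auto simp: newton_Const_mult)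
qed

lemma newton_span_basis: "\<beta> \<in> A \<Longrightarrow> newton_basis V \<beta> \<in> newton_span V A"
  unfolding newton_span_def
  by (intro image_eqI[of _ _ "Poly_Mapping.single \<beta> 1"]) (auto simp: newton_single)

lemma newton_span_zero: "0 \<in> newton_span V A"
  unfolding newton_span_def by (intro image_eqI[of _ _ 0]) auto

lemma newton_span_sum:
  "(\<And>i. i \<in> I \<Longrightarrow> f i \<in> newton_span V A) \<Longrightarrow> (\<Sum>i\<in>I. f i) \<in> newton_span V A"
  by (induction I rule: infinite_finite_induct) (simp_all add: newton_span_zero newton_span_add)

lemma newton_span_mono: "A \<subseteq> B \<Longrightarrow> newton_span V A \<subseteq> newton_span V B"
  unfolding newton_span_def by blast

text \<open>Multiplication by a variable is governed by \<open>x\<^sub>k N\<^sub>\<gamma> = N\<^sub>\<gamma>\<^sub>+\<^sub>e\<^sub>k + V\<^sub>k(\<gamma>\<^sub>k) N\<^sub>\<gamma>\<close>.\<close>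

lemma monomial_in_newton_span:
  "Poly_Mapping.single \<beta> 1 \<in> newton_span V {\<gamma>. \<gamma> \<preceq> \<beta>}"
proof (induction \<beta> rule: exp_induct)
  case zero
  have "newton_basis V 0 \<in> newton_span V {\<gamma>. \<gamma> \<preceq> 0}"
    by (rule newton_span_basis) simp
  then show ?case by simp
next
  case (add \<beta> k)
  let ?e = "Poly_Mapping.single k (1::nat)"
  let ?A = "{\<gamma>. \<gamma> \<preceq> \<beta> + ?e}"
  from add obtain c where c: "Poly_Mapping.single \<beta> 1 = newton V c" "keys c \<subseteq> {\<gamma>. \<gamma> \<preceq> \<beta>}"
    unfolding newton_span_def by blast
  have "Var k * newton_basis V \<gamma> \<in> newton_span V ?A" if "\<gamma> \<in> keys c" for \<gamma>
  proof -
    have "Var k * newton_basis V \<gamma>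
        = newton_basis V (\<gamma> + ?e) + Const (V k (lookup \<gamma> k)) * newton_basis V \<gamma>"
      by (simp only: newton_basis_add_single) (simp add: algebra_simps)
    moreover have "\<gamma> \<preceq> \<beta>"
      using that c by blast
    moreover from this have "\<gamma> \<preceq> \<beta> + ?e"
      using le_exp_trans le_exp_add(1) by blast
    ultimately show ?thesis
      by (auto intro!: newton_span_add newton_span_Const_mult newton_span_basis)
  qed
  then have "(\<Sum>\<gamma>\<in>keys c. Const (lookup c \<gamma>) * (Var k * newton_basis V \<gamma>)) \<in> newton_span V ?A"
    by (intro newton_span_sum newton_span_Const_mult)
  also have "(\<Sum>\<gamma>\<in>keys c. Const (lookup c \<gamma>) * (Var k * newton_basis V \<gamma>)) = Var k * newton V c"
    by (simp add: newton_def sum_distrib_left mult.left_commute)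
  also have "\<dots> = Poly_Mapping.single (\<beta> + ?e) 1"
    by (simp add: Var_def mult_single add.commute flip: c(1))
  finally show ?case .
qed

text \<open>Every monomial expands into basis elements below it. The support bound is what later
  confines \<eta> to the down closure and keeps expansions inside the standard exponents.\<close>

lemma newton_expansion: "\<exists>c. f = newton V c \<and> keys c \<subseteq> down_closure (keys f)"
proof -
  have "Const (lookup f \<alpha>) * Poly_Mapping.single \<alpha> 1 \<in> newton_span V (down_closure (keys f))"
    if "\<alpha> \<in> keys f" for \<alpha>
  proof -
    have "{\<gamma>. \<gamma> \<preceq> \<alpha>} \<subseteq> down_closure (keys f)"
      using that by (auto simp: down_closure_iff)
    then show ?thesis
      using monomial_in_newton_span newton_span_mono newton_span_Const_mult by blast
  qed
  then have "(\<Sum>\<alpha>\<in>keys f. Const (lookup f \<alpha>) * Poly_Mapping.single \<alpha> 1)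
      \<in> newton_span V (down_closure (keys f))"
    by (rule newton_span_sum)
  also have "(\<Sum>\<alpha>\<in>keys f. Const (lookup f \<alpha>) * Poly_Mapping.single \<alpha> 1) = f"
    by (simp add: Const_def mult_single poly_mapping_sum_single)
  finally show ?thesis
    unfolding newton_span_def by blast
qed

section \<open>Taylor coefficients of the Newton basis\<close>

text \<open>A node equal to the centre turns its factor into the bare variable; any other node
  leaves a factor whose constant term is the difference. The bare variables are collected in
  front.\<close>

lemma translate_newton_basis:
  "translate a (newton_basis V \<beta>) =
    Poly_Mapping.single (exp_of (\<lambda>k. card {i. i < lookup \<beta> k \<and> V k i = a k})) 1
      * (\<Prod>k\<in>UNIV. \<Prod>i\<in>{i. i < lookup \<beta> k \<and> V k i \<noteq> a k}. Var k + Const (a k - V k i))"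
proof -
  have "translate a (\<Prod>i<lookup \<beta> k. Var k - Const (V k i))
      = Var k ^ card {i. i < lookup \<beta> k \<and> V k i = a k}
        * (\<Prod>i\<in>{i. i < lookup \<beta> k \<and> V k i \<noteq> a k}. Var k + Const (a k - V k i))" for k
  proof -
    have "translate a (\<Prod>i<lookup \<beta> k. Var k - Const (V k i))
        = (\<Prod>i<lookup \<beta> k. if V k i = a k then Var k else Var k + Const (a k - V k i))"
      unfolding translate_prod by (rule prod.cong) (auto simp: translate_diff Const_diff)
    also have "\<dots> = (\<Prod>i\<in>{..<lookup \<beta> k} \<inter> {i. V k i = a k}. Var k)
        * (\<Prod>i\<in>{..<lookup \<beta> k} \<inter> - {i. V k i = a k}. Var k + Const (a k - V k i))"
      by (rule prod.If_cases) simp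
    finally show ?thesis
      by (simp add: Int_def Compl_eq)
  qed
  then have "translate a (newton_basis V \<beta>) =
      (\<Prod>k\<in>UNIV. Var k ^ card {i. i < lookup \<beta> k \<and> V k i = a k})
        * (\<Prod>k\<in>UNIV. \<Prod>i\<in>{i. i < lookup \<beta> k \<and> V k i \<noteq> a k}. Var k + Const (a k - V k i))"
    by (simp add: newton_basis_def translate_prod[of _ _ UNIV] prod.distrib)
  then show ?thesis
    by (simp only: prod_Var_power[of "exp_of (\<lambda>k. card {i. i < lookup \<beta> k \<and> V k i = a k})",
          unfolded lookup_exp_of])
qed

lemma keys_translate_newton_basis:
  assumes "\<gamma> \<in> keys (translate a (newton_basis V \<beta>))"
  shows "card {i. i < lookup \<beta> k \<and> V k i = a k} \<le> lookup \<gamma> k"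
  using keys_single_mult[OF assms[unfolded translate_newton_basis]] by (simp add: le_exp_def)

lemma lookup_translate_newton_basis:
  "lookup (translate a (newton_basis V \<beta>)) (exp_of (\<lambda>k. card {i. i < lookup \<beta> k \<and> V k i = a k}))
    = (\<Prod>k\<in>UNIV. \<Prod>i\<in>{i. i < lookup \<beta> k \<and> V k i \<noteq> a k}. a k - V k i)"
  (is "lookup _ ?\<mu> = _")
  by (simp add: translate_newton_basis lookup_single_mult_self lookup_prod_zero lookup_add)

lemma not_zero_divisor_prod:
  assumes "\<And>i. i \<in> A \<Longrightarrow> \<not> zero_divisor (f i)"
  shows "\<not> zero_divisor (\<Prod>i\<in>A. f i)"
  using assms
proof (induction A rule: infinite_finite_induct)
  case (insert x A)
  then show ?case
    by (simp add: zero_divisor_def mult.assoc) metis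
qed (auto simp: zero_divisor_def)

text \<open>The relevant point has as coordinates the nodes just after the first \<beta>_k ones.
  This exponent is a lower bound for all exponents in the Taylor expansion of
  \<open>newton_basis V \<beta>\<close> there.\<close>

definition node_mult :: "('n::finite \<Rightarrow> nat \<Rightarrow> 'r) \<Rightarrow> ('n \<Rightarrow>\<^sub>0 nat) \<Rightarrow> ('n \<Rightarrow>\<^sub>0 nat)"
  where "node_mult V \<beta> = exp_of (\<lambda>k. card {i. i < lookup \<beta> k \<and> V k i = V k (lookup \<beta> k)})"

text \<open>One step of a triangular elimination: the Taylor coefficient at
  \<open>node_mult V \<beta>\<close> reduces to \<open>lookup c \<beta>\<close> times a product of
  node differences.\<close>

lemma newton_coeff_zero_step:
  fixes c :: "('n::finite, 'r::comm_ring_1) mpoly"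
  assumes below: "\<And>\<beta>'. \<beta>' \<preceq> \<beta> \<Longrightarrow> \<beta>' \<noteq> \<beta> \<Longrightarrow> lookup c \<beta>' = 0"
    and regular: "\<And>k i. i < lookup \<beta> k \<Longrightarrow> V k i \<noteq> V k (lookup \<beta> k)
      \<Longrightarrow> \<not> zero_divisor (V k (lookup \<beta> k) - V k i)"
    and vanish: "lookup (translate (\<lambda>k. V k (lookup \<beta> k)) (newton V c)) (node_mult V \<beta>) = 0"
  shows "lookup c \<beta> = 0"
proof -
  define a where "a k = V k (lookup \<beta> k)" for k
  define p where
    "p = (\<Prod>k\<in>UNIV. \<Prod>i\<in>{i. i < lookup \<beta> k \<and> V k i \<noteq> a k}. a k - V k i)"
  let ?N = "\<lambda>\<beta>'. lookup (translate a (newton_basis V \<beta>')) (node_mult V \<beta>)"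
  have summand: "lookup c \<beta>' * ?N \<beta>' = (lookup c \<beta> * p when \<beta>' = \<beta>)" for \<beta>'
  proof (cases "\<beta>' \<preceq> \<beta>")
    case True
    then show ?thesis
      using below[of \<beta>'] lookup_translate_newton_basis[of a V \<beta>]
      by (auto simp: when_def node_mult_def p_def a_def)
  next
    case False
    then obtain k where k: "lookup \<beta> k < lookup \<beta>' k"
      by (auto simp: le_exp_def not_le)
    \<comment> \<open>The node at position \<beta>_k is itself \<open>a k\<close>, so a longer
      product contains one more occurrence than \<open>node_mult\<close> counts and vanishes to too
      high an order.\<close>
    have "insert (lookup \<beta> k) {i. i < lookup \<beta> k \<and> V k i = a k}
        \<subseteq> {i. i < lookup \<beta>' k \<and> V k i = a k}"
      using k by (auto simp: a_def)
    from card_mono[OF _ this] have "lookup (node_mult V \<beta>) k < card {i. i < lookup \<beta>' k \<and> V k i = a k}"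
      by (simp add: node_mult_def a_def)
    then have "?N \<beta>' = 0"
      using keys_translate_newton_basis[of "node_mult V \<beta>" a V \<beta>' k] by (auto simp: in_keys_iff)
    then show ?thesis
      using False by (auto simp: when_def)
  qed
  have "0 = (\<Sum>\<beta>'\<in>keys c. lookup c \<beta>' * ?N \<beta>')"
    using vanish
    by (simp add: newton_def translate_sum translate_mult lookup_sum lookup_Const_mult flip: a_def)
  also have "\<dots> = (\<Sum>\<beta>'\<in>keys c. lookup c \<beta> * p when \<beta>' = \<beta>)"
    by (simp only: summand)
  also have "\<dots> = p * lookup c \<beta>"
    by (simp add: when_def in_keys_iff)
  finally have "p * lookup c \<beta> = 0" by simp
  moreover have "\<not> zero_divisor p"
    unfolding p_def using regular by (intro not_zero_divisor_prod) (auto simp: a_def)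
  ultimately show ?thesis
    by (auto simp: zero_divisor_def)
qed

text \<open>Induction on the weight; as \<open>A\<close> is closed downwards, all smaller
  coefficients are already known to vanish.\<close>

lemma newton_coeff_zero:
  fixes c :: "('n::finite, 'r::comm_ring_1) mpoly"
  assumes down: "\<And>\<beta> \<beta>'. \<beta> \<in> A \<Longrightarrow> \<beta>' \<preceq> \<beta> \<Longrightarrow> \<beta>' \<in> A"
    and regular: "\<And>\<beta> k i. \<beta> \<in> A \<Longrightarrow> i < lookup \<beta> k \<Longrightarrow> V k i \<noteq> V k (lookup \<beta> k)
      \<Longrightarrow> \<not> zero_divisor (V k (lookup \<beta> k) - V k i)"
    and vanish: "\<And>\<beta>. \<beta> \<in> A
      \<Longrightarrow> lookup (translate (\<lambda>k. V k (lookup \<beta> k)) (newton V c)) (node_mult V \<beta>) = 0"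
    and "\<beta> \<in> A"
  shows "lookup c \<beta> = 0"
  using \<open>\<beta> \<in> A\<close>
proof (induction "weight \<beta>" arbitrary: \<beta> rule: less_induct)
  case (less \<beta>)
  show ?case
  proof (rule newton_coeff_zero_step[where V = V])
    fix \<beta>' assume "\<beta>' \<preceq> \<beta>" "\<beta>' \<noteq> \<beta>"
    then show "lookup c \<beta>' = 0"
      using less.hyps[of \<beta>'] weight_less down[OF less.prems] by blast
  qed (use regular vanish less.prems in blast)+
qed

section \<open>Listing roots with multiplicities\<close>

text \<open>The order of the list is left free; divisibility by the g_k / h_k later comes from
  placing the points outside \<open>E\<close> first.\<close>

definition enum_roots :: "('r \<Rightarrow> nat) \<Rightarrow> 'r set \<Rightarrow> 'r list \<Rightarrow> bool"
  where "enum_roots \<phi> T L \<longleftrightarrow> set L \<subseteq> T \<and> (\<forall>u\<in>T. count_list L u = \<phi> u)"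

lemma count_list_replicate: "count_list (replicate j u) v = (if u = v then j else 0)"
  by (induction j) auto

lemma enum_roots_append:
  assumes "enum_roots \<phi> A L" "enum_roots \<phi> B M" "A \<inter> B = {}"
  shows "enum_roots \<phi> (A \<union> B) (L @ M)"
proof -
  have "count_list M u = 0" if "u \<in> A" for u
    using assms that by (auto simp: enum_roots_def count_list_0_iff)
  moreover have "count_list L u = 0" if "u \<in> B" for u
    using assms that by (auto simp: enum_roots_def count_list_0_iff)
  ultimately show ?thesis
    using assms by (auto simp: enum_roots_def)
qed

lemma enum_roots_exists: "finite T \<Longrightarrow> \<exists>L. enum_roots \<phi> T L"
proof (induction T rule: finite_induct)
  case empty
  show ?case by (rule exI[of _ "[]"]) (simp add: enum_roots_def)
next
  case (insert u T)
  then obtain L where "enum_roots \<phi> T L" by blast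
  moreover have "enum_roots \<phi> {u} (replicate (\<phi> u) u)"
    by (auto simp: enum_roots_def count_list_replicate)
  ultimately have "enum_roots \<phi> ({u} \<union> T) (replicate (\<phi> u) u @ L)"
    using insert by (intro enum_roots_append) auto
  then show ?case by auto
qed

lemma length_enum_roots:
  assumes "enum_roots \<phi> T L" "finite T"
  shows "length L = (\<Sum>u\<in>T. \<phi> u)"
proof -
  have "(\<Sum>u\<in>T. count_list L u) = length L"
    using assms by (intro sum_count_set) (simp_all add: enum_roots_def)
  moreover have "(\<Sum>u\<in>T. count_list L u) = (\<Sum>u\<in>T. \<phi> u)"
    using assms by (intro sum.cong) (simp_all add: enum_roots_def)
  ultimately show ?thesis by simp
qed

lemma prod_list_count:
  fixes h :: "'a \<Rightarrow> 'b::comm_monoid_mult"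
  assumes "finite T"
  shows "set L \<subseteq> T \<Longrightarrow> prod_list (map h L) = (\<Prod>u\<in>T. h u ^ count_list L u)"
proof (induction L)
  case (Cons x L)
  have "(\<Prod>u\<in>T. h u ^ count_list (x # L) u)
      = (\<Prod>u\<in>T. (if u = x then h u else 1) * h u ^ count_list L u)"
    by (rule prod.cong) auto
  also have "\<dots> = h x * (\<Prod>u\<in>T. h u ^ count_list L u)"
    using Cons.prems assms by (simp add: prod.distrib)
  finally show ?case
    using Cons by simp
qed simp

lemma prod_list_conv_prod_nth:
  fixes h :: "'a \<Rightarrow> 'b::comm_monoid_mult"
  shows "prod_list (map h L) = (\<Prod>i<length L. h (L ! i))"
  by (simp add: prod.list_conv_set_nth atLeast0LessThan)

lemma prod_enum_roots:
  assumes "enum_roots (\<psi> k) (T k) L" "finite (T k)"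
  shows "(\<Prod>i<length L. Var k - Const (L ! i)) = root_prod \<psi> T k"
proof -
  have "(\<Prod>i<length L. Var k - Const (L ! i)) = (\<Prod>u\<in>T k. (Var k - Const u) ^ count_list L u)"
    using prod_list_conv_prod_nth[of "\<lambda>u. Var k - Const u" L] assms
      prod_list_count[of "T k" L "\<lambda>u. Var k - Const u"]
    by (simp add: enum_roots_def)
  then show ?thesis
    using assms by (simp add: root_prod_def enum_roots_def)
qed

section \<open>Sequences running cyclically through a list\<close>

definition cycle_nth :: "'a list \<Rightarrow> nat \<Rightarrow> 'a"
  where "cycle_nth L i = L ! (i mod length L)"

lemma cycle_nth_in_set: "L \<noteq> [] \<Longrightarrow> cycle_nth L i \<in> set L"
  by (simp add: cycle_nth_def)

lemma prod_cycle_nth: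
  fixes h :: "'a \<Rightarrow> 'b::comm_monoid_mult"
  shows "(\<Prod>i<length L * j. h (cycle_nth L i)) = (\<Prod>i<length L. h (L ! i)) ^ j"
proof (induction j)
  case (Suc j)
  have "length L * Suc j = length L * j + length L" by simp
  then show ?case
    using Suc by (simp only: prod_lessThan_add) (simp add: cycle_nth_def mult.commute)
qed simp

lemma card_cycle_nth:
  "card {i. i < length L * j \<and> cycle_nth L i = a} = count_list L a * j"
proof (induction j)
  case (Suc j)
  let ?n = "length L * j"
  have "{i. i < length L * Suc j \<and> cycle_nth L i = a}
      = {i. i < ?n \<and> cycle_nth L i = a} \<union> (\<lambda>i. ?n + i) ` {i. i < length L \<and> L ! i = a}"
    (is "?A = ?B \<union> ?f ` ?C")
  proof (intro equalityI subsetI)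
    fix i assume i: "i \<in> ?A"
    show "i \<in> ?B \<union> ?f ` ?C"
    proof (cases "i < ?n")
      case False
      then obtain r where r: "i = ?n + r"
        using le_Suc_ex not_less by blast
      then have "r \<in> ?C"
        using i by (auto simp: cycle_nth_def)
      then show ?thesis using r by blast
    qed (use i in auto)
  qed (auto simp: cycle_nth_def)
  moreover have "card (?f ` ?C) = card ?C"
    by (rule card_image) simp
  moreover have "card ?C = count_list L a"
    by (simp add: count_list_eq_length_filter length_filter_conv_card eq_commute)
  moreover have "?B \<inter> ?f ` ?C = {}" by auto
  ultimately show ?case
    using Suc by (simp add: card_Un_disjoint)
qed simp

text \<open>Position \<open>i\<close> lies in round \<open>i div length L\<close>. The right-hand
  side counts all occurrences up to the end of that round, and the one at \<open>i\<close> is not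
  among the earlier ones, so the bound is strict.\<close>

lemma card_cycle_nth_less:
  assumes "L \<noteq> []"
  shows "card {j. j < i \<and> cycle_nth L j = cycle_nth L i}
    < count_list L (cycle_nth L i) * Suc (i div length L)"
proof -
  let ?A = "{j. j < i \<and> cycle_nth L j = cycle_nth L i}"
  let ?B = "{j. j < length L * Suc (i div length L) \<and> cycle_nth L j = cycle_nth L i}"
  have "i < length L * Suc (i div length L)"
    using assms dividend_less_times_div[of "length L" i] by simp
  then have "insert i ?A \<subseteq> ?B" by auto
  from card_mono[OF _ this] have "card ?A < card ?B" by simp
  then show ?thesis by (simp only: card_cycle_nth)
qed

text \<open>Fewer than \<phi>(u) (q + 1) earlier occurrences of u give a quotient of at most q, the
  number of the round. Here the floors of the vanishing condition meet the cyclic nodes.\<close>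

lemma card_cycle_nth_div:
  assumes "enum_roots \<phi> T L" "L \<noteq> []"
  shows "card {j. j < i \<and> cycle_nth L j = cycle_nth L i} div \<phi> (cycle_nth L i) \<le> i div length L"
proof -
  have "count_list L (cycle_nth L i) = \<phi> (cycle_nth L i)"
    using assms cycle_nth_in_set[of L i] by (auto simp: enum_roots_def)
  then show ?thesis
    using card_cycle_nth_less[OF assms(2), of i]
    by (metis less_Suc_eq_le less_mult_imp_div_less mult.commute)
qed

section \<open>Power ideals and vanishing conditions\<close>

lemma ideal_gen_base: "x \<in> A \<Longrightarrow> x \<in> ideal_gen A"
  unfolding ideal_gen_def by (rule module.span_base[OF module_mult])

lemma ideal_gen_diff: "x \<in> ideal_gen A \<Longrightarrow> y \<in> ideal_gen A \<Longrightarrow> x - y \<in> ideal_gen A"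
  unfolding ideal_gen_def by (rule module.span_diff[OF module_mult])

lemma ideal_gen_mult: "x \<in> ideal_gen A \<Longrightarrow> r * x \<in> ideal_gen A"
  unfolding ideal_gen_def by (rule module.span_scale[OF module_mult])

lemma ideal_gen_sum: "(\<And>i. i \<in> I \<Longrightarrow> f i \<in> ideal_gen A) \<Longrightarrow> (\<Sum>i\<in>I. f i) \<in> ideal_gen A"
  unfolding ideal_gen_def by (rule module.span_sum[OF module_mult])

lemma ideal_gen_minimal:
  assumes "A \<subseteq> T" "0 \<in> T" "\<And>x y. x \<in> T \<Longrightarrow> y \<in> T \<Longrightarrow> x + y \<in> T" "\<And>r x. x \<in> T \<Longrightarrow> r * x \<in> T"
  shows "ideal_gen A \<subseteq> T"
  unfolding ideal_gen_def using assms
  by (intro module.span_minimal[OF module_mult] module.subspaceI[OF module_mult]) auto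

text \<open>
  The exponents of the monomials, and equally of the Newton basis elements, that are not leading
  exponents of the ideal.
\<close>

definition standard :: "nat \<Rightarrow> ('n::finite \<Rightarrow> nat) \<Rightarrow> ('n \<Rightarrow>\<^sub>0 nat) set"
  where "standard t d = {\<beta>. \<forall>\<alpha>. weight \<alpha> = t \<longrightarrow> (\<exists>k. lookup \<beta> k < d k * lookup \<alpha> k)}"

lemma reduced_iff: "reduced t d \<eta> \<longleftrightarrow> keys \<eta> \<subseteq> standard t d"
proof -
  have "int x \<le> int y - 1 \<longleftrightarrow> x < y" for x y :: nat by auto
  then show ?thesis
    unfolding reduced_def standard_def by (simp only:) blast
qed

lemma standard_down: "\<beta> \<in> standard t d \<Longrightarrow> \<beta>' \<preceq> \<beta> \<Longrightarrow> \<beta>' \<in> standard t d"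
  unfolding standard_def le_exp_def using le_less_trans by blast

text \<open>Test with \<alpha> concentrated on \<open>k\<close>: a strict inequality is then
  possible only in that coordinate. One standard exponent thus makes every root list
  nonempty.\<close>

lemma standard_pos:
  assumes "\<beta> \<in> standard t d"
  shows "d k > 0"
proof -
  from assms obtain j where "lookup \<beta> j < d j * lookup (Poly_Mapping.single k t) j"
    unfolding standard_def using weight_single by blast
  then show ?thesis
    by (cases "d j = 0") (auto simp: lookup_single when_def split: if_splits)
qed

text \<open>If the floors added up to \<open>t\<close> or more, some \<alpha> of weight
  \<open>t\<close> below them would satisfy d_k \<alpha>_k \<le> \<beta>_k throughout.\<close>

lemma standard_sum_less:
  assumes "\<beta> \<in> standard t d"
  shows "(\<Sum>k\<in>UNIV. lookup \<beta> k div d k) < t"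
proof (rule ccontr)
  assume "\<not> ?thesis"
  then obtain \<alpha> where \<alpha>: "weight \<alpha> = t" "\<And>k. lookup \<alpha> k \<le> lookup \<beta> k div d k"
    using exists_exp_le_weight[of t "\<lambda>k. lookup \<beta> k div d k"] by (auto simp: not_less)
  have "d k * lookup \<alpha> k \<le> lookup \<beta> k" for k
    using mult_le_mono2[OF \<alpha>(2), of "d k" k] times_div_less_eq_dividend order_trans by blast
  then show False
    using assms \<alpha>(1) leD unfolding standard_def by blast
qed

text \<open>A non-standard \<beta> lies above some vector d_k \<alpha>_k with \<alpha> of weight
  \<open>t\<close>. The nodes up to that vector multiply to a generator, which divides the basis
  element.\<close>

lemma newton_mem_power_ideal:
  assumes prod: "\<And>k j. (\<Prod>i<d k * j. Var k - Const (V k i)) = q k ^ j"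
    and keys: "keys c \<inter> standard t d = {}"
  shows "newton V c \<in> power_ideal t q"
proof -
  have "newton_basis V \<beta> \<in> power_ideal t q" if "\<beta> \<in> keys c" for \<beta>
  proof -
    have "\<beta> \<notin> standard t d"
      using that keys by blast
    then obtain \<alpha> where \<alpha>: "weight \<alpha> = t" "\<And>k. d k * lookup \<alpha> k \<le> lookup \<beta> k"
      unfolding standard_def by (auto simp: not_less)
    let ?\<mu> = "exp_of (\<lambda>k. d k * lookup \<alpha> k)"
    have "newton_basis V ?\<mu> = (\<Prod>k\<in>UNIV. q k ^ lookup \<alpha> k)"
      by (simp add: newton_basis_def prod)
    then have "newton_basis V ?\<mu> \<in> power_ideal t q"
      unfolding power_ideal_def using \<alpha>(1) by (auto intro: ideal_gen_base)
    then have "newton_basis V (?\<mu> + (\<beta> - ?\<mu>)) \<in> power_ideal t q"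
      unfolding newton_basis_add power_ideal_def mult.commute[of "newton_basis V ?\<mu>"]
      by (rule ideal_gen_mult)
    moreover have "?\<mu> + (\<beta> - ?\<mu>) = \<beta>"
      using le_exp_add_diff[of ?\<mu> \<beta>] \<alpha>(2) by (simp add: le_exp_def add.commute)
    ultimately show ?thesis by simp
  qed
  then show ?thesis
    unfolding newton_def power_ideal_def by (auto intro!: ideal_gen_sum ideal_gen_mult)
qed

text \<open>Over the integers \<open>t - 1\<close> is negative at \<open>t = 0\<close>, so the
  condition is vacuous there, as is the strict inequality of naturals.\<close>

lemma vanishing_cond_iff:
  "vanishing_cond S E \<psi> t f \<longleftrightarrow>
    (\<forall>a\<in>Pi UNIV S - Pi UNIV E. \<forall>\<beta>. (\<Sum>i\<in>UNIV. lookup \<beta> i div \<psi> i (a i)) < t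
      \<longrightarrow> lookup (translate a f) \<beta> = 0)"
proof -
  have "int x \<le> int t - 1 \<longleftrightarrow> x < t" for x by auto
  then show ?thesis
    unfolding vanishing_cond_def by (simp only:)
qed

section \<open>The power ideal of a grid described by vanishing Taylor coefficients\<close>

locale grid =
  fixes S :: "'n::finite \<Rightarrow> 'r::comm_ring_1 set" and \<psi> :: "'n \<Rightarrow> 'r \<Rightarrow> nat"
  assumes finite_S: "finite (S k)"
    and cond_D: "condition_D (S k)"
    and mult_pos: "u \<in> S k \<Longrightarrow> \<psi> k u > 0"
begin

definition "deg k = (\<Sum>u\<in>S k. \<psi> k u)"

lemma not_zero_divisor_diff:
  "a \<in> S k \<Longrightarrow> b \<in> S k \<Longrightarrow> b \<noteq> a \<Longrightarrow> \<not> zero_divisor (a - b)"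
  using cond_D[of k] unfolding condition_D_def by blast

text \<open>The polynomials whose Taylor exponents at \<open>a\<close> all have floor sum at least
  \<open>t\<close> form an ideal, and this ideal contains the generators.\<close>

lemma power_ideal_vanishes:
  assumes "f \<in> power_ideal t (root_prod \<psi> S)" "a \<in> Pi UNIV S"
    and "(\<Sum>i\<in>UNIV. lookup \<gamma> i div \<psi> i (a i)) < t"
  shows "lookup (translate a f) \<gamma> = 0"
proof -
  let ?w = "\<lambda>\<gamma>. \<Sum>i\<in>UNIV. lookup \<gamma> i div \<psi> i (a i)"
  let ?T = "{f. \<forall>\<gamma>\<in>keys (translate a f). t \<le> ?w \<gamma>}"
  have generator: "(\<Prod>k\<in>UNIV. root_prod \<psi> S k ^ lookup \<alpha> k) \<in> ?T" if "weight \<alpha> = t" for \<alpha>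
  proof -
    let ?\<mu> = "exp_of (\<lambda>k. \<psi> k (a k) * lookup \<alpha> k)"
    define r where "r k = (\<Prod>u\<in>S k - {a k}. (Var k - Const u) ^ \<psi> k u)" for k
    \<comment> \<open>Only the root \<open>a k\<close> matters: translation turns its factor into a
      power of the bare variable.\<close>
    have "root_prod \<psi> S k = (Var k - Const (a k)) ^ \<psi> k (a k) * r k" for k
      unfolding root_prod_def r_def using assms(2) finite_S by (intro prod.remove) auto
    then have "translate a (\<Prod>k\<in>UNIV. root_prod \<psi> S k ^ lookup \<alpha> k)
        = (\<Prod>k\<in>UNIV. Var k ^ lookup ?\<mu> k) * (\<Prod>k\<in>UNIV. translate a (r k) ^ lookup \<alpha> k)"
      by (simp add: translate_prod translate_power translate_mult translate_diff power_mult_distrib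
          prod.distrib power_mult)
    then have eq: "translate a (\<Prod>k\<in>UNIV. root_prod \<psi> S k ^ lookup \<alpha> k)
        = Poly_Mapping.single ?\<mu> 1 * (\<Prod>k\<in>UNIV. translate a (r k) ^ lookup \<alpha> k)"
      by (simp only: prod_Var_power)
    have "t \<le> ?w \<gamma>" if "?\<mu> \<preceq> \<gamma>" for \<gamma>
    proof -
      have "\<psi> k (a k) * lookup \<alpha> k \<le> lookup \<gamma> k" "\<psi> k (a k) > 0" for k
        using that assms(2) mult_pos by (auto simp: le_exp_def)
      then have "lookup \<alpha> k \<le> lookup \<gamma> k div \<psi> k (a k)" for k
        by (simp add: less_eq_div_iff_mult_less_eq mult.commute)
      then show ?thesis
        unfolding \<open>weight \<alpha> = t\<close>[symmetric] weight_def by (intro sum_mono)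
    qed
    then show ?thesis
      by (auto simp: eq dest: keys_single_mult)
  qed
  have "power_ideal t (root_prod \<psi> S) \<subseteq> ?T"
    unfolding power_ideal_def
  proof (rule ideal_gen_minimal)
    fix f g assume "f \<in> ?T" "g \<in> ?T"
    then show "f + g \<in> ?T"
      using keys_add[of "translate a f" "translate a g"] by (auto simp: translate_add)
  next
    fix r f assume f: "f \<in> ?T"
    have "t \<le> ?w \<gamma>" if \<gamma>: "\<gamma> \<in> keys (translate a (r * f))" for \<gamma>
    proof -
      obtain \<delta> \<epsilon> where *: "\<gamma> = \<delta> + \<epsilon>" "\<epsilon> \<in> keys (translate a f)"
        using \<gamma> keys_mult[of "translate a r" "translate a f"] by (auto simp: translate_mult)
      then have "t \<le> ?w \<epsilon>" using f by blast
      also have "\<dots> \<le> ?w \<gamma>"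
        unfolding * by (intro sum_mono div_le_mono) (simp add: lookup_add)
      finally show ?thesis .
    qed
    then show "r * f \<in> ?T" by blast
  qed (use generator in auto)
  then have "\<gamma> \<notin> keys (translate a f)"
    using assms(1,3) by fastforce
  then show ?thesis
    by (simp add: in_keys_iff)
qed

context
  fixes L :: "'n \<Rightarrow> 'r list" and t :: nat
  assumes enum: "\<And>k. enum_roots (\<psi> k) (S k) (L k)"
begin

abbreviation "nodes \<equiv> \<lambda>k. cycle_nth (L k)"

lemma length_enum: "length (L k) = deg k"
  unfolding deg_def by (rule length_enum_roots[OF enum finite_S])

lemma node_in_S: "\<beta> \<in> standard t deg \<Longrightarrow> nodes k i \<in> S k"
  using standard_pos[of \<beta> t deg k] cycle_nth_in_set[of "L k" i] enum[of k]
  by (auto simp: enum_roots_def simp flip: length_enum)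

text \<open>Each summand is at most \<beta>_k div deg_k, and these add up to less than
  \<open>t\<close>. Elimination at standard exponents thus consults only Taylor coefficients within
  the range of the vanishing condition.\<close>

lemma node_mult_less:
  assumes "\<beta> \<in> standard t deg"
  shows "(\<Sum>k\<in>UNIV. lookup (node_mult nodes \<beta>) k div \<psi> k (nodes k (lookup \<beta> k))) < t"
proof -
  have "L k \<noteq> []" for k
    using standard_pos[OF assms, of k] by (auto simp flip: length_enum)
  then have "lookup (node_mult nodes \<beta>) k div \<psi> k (nodes k (lookup \<beta> k)) \<le> lookup \<beta> k div deg k" for k
    unfolding node_mult_def by (simp add: card_cycle_nth_div[OF enum] flip: length_enum)
  then have "(\<Sum>k\<in>UNIV. lookup (node_mult nodes \<beta>) k div \<psi> k (nodes k (lookup \<beta> k)))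
      \<le> (\<Sum>k\<in>UNIV. lookup \<beta> k div deg k)"
    by (intro sum_mono)
  then show ?thesis
    using standard_sum_less[OF assms] by simp
qed

text \<open>\<open>A\<close> is kept general: all standard exponents serve for ideal membership, and
  a smaller down-closed set serves for divisibility on the punctured grid.\<close>

lemma standard_coeff_zero:
  assumes down: "\<And>\<beta> \<beta>'. \<beta> \<in> A \<Longrightarrow> \<beta>' \<preceq> \<beta> \<Longrightarrow> \<beta>' \<in> A"
    and sub: "A \<subseteq> standard t deg"
    and vanish: "\<And>\<beta> \<gamma>. \<beta> \<in> A
      \<Longrightarrow> (\<Sum>i\<in>UNIV. lookup \<gamma> i div \<psi> i (nodes i (lookup \<beta> i))) < t
      \<Longrightarrow> lookup (translate (\<lambda>i. nodes i (lookup \<beta> i)) (newton nodes c)) \<gamma> = 0"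
    and "\<beta> \<in> A"
  shows "lookup c \<beta> = 0"
proof (rule newton_coeff_zero[where A = A and V = nodes])
  fix \<beta> k i assume "\<beta> \<in> A" "nodes k i \<noteq> nodes k (lookup \<beta> k)"
  then show "\<not> zero_divisor (nodes k (lookup \<beta> k) - nodes k i)"
    using sub node_in_S by (intro not_zero_divisor_diff) auto
next
  fix \<beta> assume "\<beta> \<in> A"
  then show "lookup (translate (\<lambda>k. nodes k (lookup \<beta> k)) (newton nodes c)) (node_mult nodes \<beta>) = 0"
    using vanish node_mult_less sub by blast
qed (use assms in blast)+

lemma standard_coeff_zero_of_mem:
  assumes "newton nodes c \<in> power_ideal t (root_prod \<psi> S)" "\<beta> \<in> standard t deg"
  shows "lookup c \<beta> = 0"
proof (rule standard_coeff_zero[where A = "standard t deg"])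
  fix \<beta> \<gamma> assume "\<beta> \<in> standard t deg"
    and "(\<Sum>i\<in>UNIV. lookup \<gamma> i div \<psi> i (nodes i (lookup \<beta> i))) < t"
  then show "lookup (translate (\<lambda>i. nodes i (lookup \<beta> i)) (newton nodes c)) \<gamma> = 0"
    using node_in_S by (intro power_ideal_vanishes[OF assms(1)]) auto
qed (use assms standard_down in auto)

lemma newton_mem_root_ideal:
  assumes "keys c \<inter> standard t deg = {}"
  shows "newton nodes c \<in> power_ideal t (root_prod \<psi> S)"
proof (rule newton_mem_power_ideal[OF _ assms])
  show "(\<Prod>i<deg k * j. Var k - Const (nodes k i)) = root_prod \<psi> S k ^ j" for k j
    using prod_cycle_nth[of "\<lambda>u. Var k - Const u" "L k" j]
      prod_enum_roots[where \<psi> = \<psi> and T = S and k = k, OF enum finite_S]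
    by (simp add: length_enum)
qed

end

lemma enum_exists: "\<exists>L. \<forall>k. enum_roots (\<psi> k) (S k) (L k)"
  by (intro choice allI enum_roots_exists finite_S)

text \<open>For the converse, vanishing eliminates every standard Newton coefficient, and the other
  basis elements are multiples of generators.\<close>

lemma mem_power_ideal_iff:
  "f \<in> power_ideal t (root_prod \<psi> S) \<longleftrightarrow>
    (\<forall>a\<in>Pi UNIV S. \<forall>\<gamma>. (\<Sum>i\<in>UNIV. lookup \<gamma> i div \<psi> i (a i)) < t
      \<longrightarrow> lookup (translate a f) \<gamma> = 0)"
proof
  assume vanish: "\<forall>a\<in>Pi UNIV S. \<forall>\<gamma>. (\<Sum>i\<in>UNIV. lookup \<gamma> i div \<psi> i (a i)) < t
      \<longrightarrow> lookup (translate a f) \<gamma> = 0"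
  obtain L where enum: "\<And>k. enum_roots (\<psi> k) (S k) (L k)"
    using enum_exists by blast
  obtain c where c: "f = newton (\<lambda>k. cycle_nth (L k)) c"
    using newton_expansion by blast
  have "lookup c \<beta> = 0" if "\<beta> \<in> standard t deg" for \<beta>
  proof (rule standard_coeff_zero[where A = "standard t deg", OF enum])
    fix \<beta> \<gamma> assume *: "\<beta> \<in> standard t deg"
      "(\<Sum>i\<in>UNIV. lookup \<gamma> i div \<psi> i (cycle_nth (L i) (lookup \<beta> i))) < t"
    then have "(\<lambda>i. cycle_nth (L i) (lookup \<beta> i)) \<in> Pi UNIV S"
      using node_in_S[OF enum] by auto
    from vanish[rule_format, OF this *(2)]
    show "lookup (translate (\<lambda>i. cycle_nth (L i) (lookup \<beta> i))
        (newton (\<lambda>k. cycle_nth (L k)) c)) \<gamma> = 0"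
      by (simp add: c)
  qed (use that standard_down in auto)
  then show "f \<in> power_ideal t (root_prod \<psi> S)"
    unfolding c by (intro newton_mem_root_ideal[OF enum]) (auto simp: in_keys_iff)
qed (use power_ideal_vanishes in blast)

section \<open>Remainders modulo the power ideal: existence, support and uniqueness\<close>

lemma remainder_exists:
  "\<exists>\<eta>. f - \<eta> \<in> power_ideal t (root_prod \<psi> S) \<and> keys \<eta> \<subseteq> standard t deg
    \<and> keys \<eta> \<subseteq> down_closure (keys f)"
proof -
  obtain L where enum: "\<And>k. enum_roots (\<psi> k) (S k) (L k)"
    using enum_exists by blast
  let ?V = "\<lambda>k. cycle_nth (L k)"
  obtain c where c: "f = newton ?V c" "keys c \<subseteq> down_closure (keys f)"
    using newton_expansion by blast
  \<comment> \<open>The remainder is the Newton expansion cut down to standard exponents; the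
    discarded part lies in the ideal.\<close>
  define c' where
    "c' = (\<Sum>\<beta>\<in>keys c \<inter> standard t deg. Poly_Mapping.single \<beta> (lookup c \<beta>))"
  have lookup_c': "lookup c' \<beta> = (lookup c \<beta> when \<beta> \<in> standard t deg)" for \<beta>
    by (auto simp: c'_def lookup_sum lookup_single when_def in_keys_iff)
  have keys_c': "keys c' = keys c \<inter> standard t deg"
    by (auto simp: in_keys_iff lookup_c')
  have "f - newton ?V c' = newton ?V (c - c')"
    by (simp add: c newton_diff)
  also have "\<dots> \<in> power_ideal t (root_prod \<psi> S)"
    by (rule newton_mem_root_ideal[OF enum]) (auto simp: in_keys_iff lookup_minus lookup_c')
  finally have "f - newton ?V c' \<in> power_ideal t (root_prod \<psi> S)" .
  moreover have "keys (newton ?V c') \<subseteq> standard t deg"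
    using keys_newton[of _ ?V c'] standard_down keys_c' by blast
  moreover have "keys (newton ?V c') \<subseteq> down_closure (keys f)"
    using keys_newton[of _ ?V c'] keys_c' c(2) le_exp_trans by (fastforce simp: down_closure_iff)
  ultimately show ?thesis by blast
qed

lemma keys_expansion_standard:
  assumes "keys \<eta> \<subseteq> standard t deg"
  shows "\<exists>c. \<eta> = newton V c \<and> keys c \<subseteq> standard t deg"
  using newton_expansion[of \<eta> V] assms standard_down by (fastforce simp: down_closure_iff)

text \<open>Membership eliminates the coefficients at standard exponents, and the expansion has no
  others.\<close>

lemma remainder_zero:
  assumes "\<eta> \<in> power_ideal t (root_prod \<psi> S)" "keys \<eta> \<subseteq> standard t deg"
  shows "\<eta> = 0"
proof -
  obtain L where enum: "\<And>k. enum_roots (\<psi> k) (S k) (L k)"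
    using enum_exists by blast
  obtain c where c: "\<eta> = newton (\<lambda>k. cycle_nth (L k)) c" "keys c \<subseteq> standard t deg"
    using keys_expansion_standard[OF assms(2)] by blast
  have "lookup c \<beta> = 0" for \<beta>
    using standard_coeff_zero_of_mem[OF enum] assms(1) c
    by (metis in_keys_iff subsetD)
  then have "c = 0"
    by (intro poly_mapping_eqI) simp
  then show ?thesis by (simp add: c)
qed

lemma remainder_unique:
  assumes "f - \<eta> \<in> power_ideal t (root_prod \<psi> S)" "keys \<eta> \<subseteq> standard t deg"
    and "f - \<theta> \<in> power_ideal t (root_prod \<psi> S)" "keys \<theta> \<subseteq> standard t deg"
  shows "\<eta> = \<theta>"
proof -
  have "(f - \<theta>) - (f - \<eta>) \<in> power_ideal t (root_prod \<psi> S)"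
    using assms(3,1) unfolding power_ideal_def by (rule ideal_gen_diff)
  moreover have "keys (\<eta> - \<theta>) \<subseteq> standard t deg"
    using assms(2,4) keys_diff[of \<eta> \<theta>] by blast
  ultimately have "\<eta> - \<theta> = 0"
    by (intro remainder_zero) simp_all
  then show ?thesis by simp
qed

end

section \<open>The punctured grid\<close>

text \<open>Multiplying the coefficients by a monomial shifts their indices. A cofactor expanded in
  the remaining nodes thus gives an expansion of the product in the full node sequence.\<close>

lemma newton_shift:
  "newton V (Poly_Mapping.single \<epsilon> 1 * c)
    = newton_basis V \<epsilon> * newton (\<lambda>k i. V k (lookup \<epsilon> k + i)) c"
  by (induction c rule: mpoly_induct)
     (simp_all add: ring_distribs newton_add newton_single mult_single newton_basis_add
       mult.left_commute)

locale punctured_grid = grid S \<psi> for S :: "'n::finite \<Rightarrow> 'r::comm_ring_1 set" and \<psi> +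
  fixes E :: "'n \<Rightarrow> 'r set"
  assumes E_subset: "E k \<subseteq> S k"
begin

lemma enum_punctured:
  obtains P where "\<And>k. enum_roots (\<psi> k) (S k - E k) (P k)"
    and "\<And>k. (\<Prod>i<length (P k). Var k - Const (P k ! i)) = root_prod \<psi> (\<lambda>i. S i - E i) k"
    and "\<And>k. length (P k) = (\<Sum>u\<in>S k - E k. \<psi> k u)"
proof -
  have "\<exists>P. \<forall>k. enum_roots (\<psi> k) (S k - E k) (P k)"
    by (intro choice allI enum_roots_exists finite_Diff finite_S)
  then obtain P where P: "\<And>k. enum_roots (\<psi> k) (S k - E k) (P k)" by blast
  then show thesis
    using prod_enum_roots[where \<psi> = \<psi> and T = "\<lambda>i. S i - E i"] length_enum_roots finite_S
    by (intro that) blast+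
qed

lemma root_prod_dvd_remainder:
  assumes "vanishing_cond S E \<psi> t \<eta>" "keys \<eta> \<subseteq> standard t deg"
  shows "(\<Prod>k\<in>UNIV. root_prod \<psi> (\<lambda>i. S i - E i) k) dvd \<eta>"
proof -
  obtain P where P: "\<And>k. enum_roots (\<psi> k) (S k - E k) (P k)"
    "\<And>k. (\<Prod>i<length (P k). Var k - Const (P k ! i)) = root_prod \<psi> (\<lambda>i. S i - E i) k"
    "\<And>k. length (P k) = (\<Sum>u\<in>S k - E k. \<psi> k u)"
    using enum_punctured by blast
  have "\<exists>Q. \<forall>k. enum_roots (\<psi> k) (E k) (Q k)"
    using E_subset finite_S by (intro choice allI enum_roots_exists) (rule finite_subset)
  then obtain Q where Q: "\<And>k. enum_roots (\<psi> k) (E k) (Q k)" by blast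
  \<comment> \<open>The roots outside \<open>E\<close> come first, so the first
    \<open>length (P k)\<close> nodes multiply to g_k / h_k.\<close>
  define L where "L k = P k @ Q k" for k
  have enum: "enum_roots (\<psi> k) (S k) (L k)" for k
  proof -
    have "enum_roots (\<psi> k) (S k - E k \<union> E k) (L k)"
      unfolding L_def by (intro enum_roots_append P Q) auto
    then show ?thesis
      using E_subset[of k] by (simp add: Un_absorb2)
  qed
  define V where "V = (\<lambda>k. cycle_nth (L k))"
  let ?\<epsilon> = "exp_of (\<lambda>k. length (P k))"
  have V_P: "V k i = P k ! i" if "i < length (P k)" for k i
    using that by (simp add: V_def cycle_nth_def L_def nth_append)
  obtain c where c: "\<eta> = newton V c" "keys c \<subseteq> standard t deg"
    using keys_expansion_standard[OF assms(2)] by blast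
  \<comment> \<open>For such \<beta> and \<open>k\<close> the next node lies in
    \<open>S k - E k\<close>, so the associated point is outside the product of the
    \<open>E k\<close>, where vanishing is assumed.\<close>
  let ?A = "{\<beta> \<in> standard t deg. \<exists>k. lookup \<beta> k < length (P k)}"
  have zero: "lookup c \<beta> = 0" if "\<beta> \<in> ?A" for \<beta>
  proof (rule standard_coeff_zero[OF enum, where A = ?A])
    fix \<beta> \<beta>' assume "\<beta> \<in> ?A" "\<beta>' \<preceq> \<beta>"
    then show "\<beta>' \<in> ?A"
      using standard_down[of \<beta> t deg \<beta>'] by (auto simp: le_exp_def intro: le_less_trans)
  next
    fix \<beta> \<gamma> assume \<beta>: "\<beta> \<in> ?A"
      and \<gamma>: "(\<Sum>i\<in>UNIV. lookup \<gamma> i div \<psi> i (cycle_nth (L i) (lookup \<beta> i))) < t"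
    let ?a = "\<lambda>i. cycle_nth (L i) (lookup \<beta> i)"
    have "?a \<in> Pi UNIV S"
      using \<beta> node_in_S[OF enum] by auto
    moreover obtain k where "lookup \<beta> k < length (P k)"
      using \<beta> by auto
    then have "?a k \<in> S k - E k"
      using V_P[of "lookup \<beta> k" k] P(1)[of k] nth_mem unfolding V_def enum_roots_def by fastforce
    then have "?a \<notin> Pi UNIV E" by auto
    ultimately have "?a \<in> Pi UNIV S - Pi UNIV E" by blast
    from assms(1)[unfolded vanishing_cond_iff, rule_format, OF this \<gamma>]
    show "lookup (translate ?a (newton (\<lambda>k. cycle_nth (L k)) c)) \<gamma> = 0"
      by (simp add: c V_def)
  qed (use that in auto)
  have "newton_basis V ?\<epsilon> dvd newton_basis V \<beta>" if "\<beta> \<in> keys c" for \<beta>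
  proof -
    have "\<beta> \<notin> ?A"
      using zero[of \<beta>] that by (auto simp: in_keys_iff)
    then have "\<not> lookup \<beta> k < length (P k)" for k
      using that c(2) by blast
    then have "?\<epsilon> + (\<beta> - ?\<epsilon>) = \<beta>"
      using le_exp_add_diff[of ?\<epsilon> \<beta>] by (simp add: le_exp_def not_less add.commute)
    then show ?thesis
      using newton_basis_add[of V ?\<epsilon> "\<beta> - ?\<epsilon>"] by simp
  qed
  then have "newton_basis V ?\<epsilon> dvd \<eta>"
    unfolding c newton_def by (intro dvd_sum dvd_mult)
  moreover have "newton_basis V ?\<epsilon> = (\<Prod>k\<in>UNIV. root_prod \<psi> (\<lambda>i. S i - E i) k)"
    by (simp add: newton_basis_def V_P P(2))
  ultimately show ?thesis by simp
qed

text \<open>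
  The cofactor of \<open>\<eta>\<close> is expanded in a Newton basis whose nodes run \<open>t - 1\<close> times through the
  roots of \<open>g\<^sub>m / h\<^sub>m\<close> in the variable \<open>x\<^sub>m\<close>, and are constantly \<open>w\<^sub>k\<close> in the other variables. The
  basis elements that do not vanish at \<open>w\<close> then involve only \<open>x\<^sub>m\<close>.
\<close>

lemma total_deg_ge:
  assumes vanish: "vanishing_cond S E \<psi> t \<eta>"
    and dvd: "(\<Prod>k\<in>UNIV. root_prod \<psi> (\<lambda>i. S i - E i) k) dvd \<eta>"
    and t: "t \<ge> 1" and w: "w \<in> Pi UNIV S" and nonzero: "eval_mpoly w \<eta> \<noteq> 0"
  shows "total_deg \<eta> \<ge> ereal (real ((t - 1) * (\<Sum>u\<in>S m - E m. \<psi> m u)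
    + (\<Sum>k\<in>UNIV. \<Sum>u\<in>S k - E k. \<psi> k u)))"
proof -
  obtain P where P: "\<And>k. enum_roots (\<psi> k) (S k - E k) (P k)"
    "\<And>k. (\<Prod>i<length (P k). Var k - Const (P k ! i)) = root_prod \<psi> (\<lambda>i. S i - E i) k"
    "\<And>k. length (P k) = (\<Sum>u\<in>S k - E k. \<psi> k u)"
    using enum_punctured by blast
  \<comment> \<open>Outside the product of the \<open>E k\<close> the value itself would vanish,
    since the exponent 0 has floor sum 0 < t.\<close>
  have wE: "w k \<in> E k" for k
  proof -
    have "w \<in> Pi UNIV E"
    proof (rule ccontr)
      assume "w \<notin> Pi UNIV E"
      then have "lookup (translate w \<eta>) 0 = 0"
        using vanish w t unfolding vanishing_cond_iff by simp
      then show False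
        using nonzero by (simp add: eval_mpoly_eq)
    qed
    then show ?thesis by auto
  qed
  have w_notin: "w k \<notin> set (P k)" for k
    using wE[of k] P(1)[of k] by (auto simp: enum_roots_def)
  \<comment> \<open>One round in every variable accounts for the known factor of \<eta>; the other t
    - 1 rounds in x_m are left for the cofactor.\<close>
  define \<tau> where "\<tau> k = (if k = m then t else 1) * length (P k)" for k
  define V where "V k i = (if i < \<tau> k then cycle_nth (P k) i else w k)" for k i
  let ?\<epsilon> = "exp_of (\<lambda>k. length (P k))"
  let ?W = "\<lambda>k i. V k (lookup ?\<epsilon> k + i)"
  have \<tau>_ge: "length (P k) \<le> \<tau> k" for k
    using t by (simp add: \<tau>_def)
  have in_P: "cycle_nth (P k) i \<in> set (P k)" if "i < \<tau> k" for k i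
    using that by (intro cycle_nth_in_set) (auto simp: \<tau>_def)
  have V_in_S: "V k i \<in> S k" for k i
    using in_P[of i k] P(1)[of k] w by (auto simp: V_def enum_roots_def)
  have "newton_basis V ?\<epsilon> = (\<Prod>k\<in>UNIV. \<Prod>i<length (P k). Var k - Const (P k ! i))"
    unfolding newton_basis_def
    using less_le_trans[OF _ \<tau>_ge] by (intro prod.cong) (auto simp: V_def cycle_nth_def)
  then have basis: "newton_basis V ?\<epsilon> = (\<Prod>k\<in>UNIV. root_prod \<psi> (\<lambda>i. S i - E i) k)"
    by (simp add: P(2))
  obtain \<zeta> where \<zeta>: "\<eta> = newton_basis V ?\<epsilon> * \<zeta>"
    using dvd unfolding basis by (rule dvdE)
  obtain c where c: "\<zeta> = newton ?W c"
    using newton_expansion by blast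
  let ?c = "Poly_Mapping.single ?\<epsilon> 1 * c"
  have \<eta>: "\<eta> = newton V ?c"
    unfolding newton_shift \<zeta> c ..
  \<comment> \<open>The strict bound at \<open>m\<close> keeps that coordinate of the associated
    point outside \<open>E m\<close>. Elsewhere equality is allowed, and the next node is then
    \<open>w k\<close>.\<close>
  let ?A = "{\<beta>. lookup \<beta> m < \<tau> m \<and> (\<forall>k. k \<noteq> m \<longrightarrow> lookup \<beta> k \<le> \<tau> k)}"
  have zero: "lookup ?c \<beta> = 0" if "\<beta> \<in> ?A" for \<beta>
  proof (rule newton_coeff_zero[where A = ?A and V = V])
    fix \<beta> \<beta>' assume "\<beta> \<in> ?A" "\<beta>' \<preceq> \<beta>"
    then show "\<beta>' \<in> ?A"
      by (auto simp: le_exp_def intro: le_less_trans order_trans)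
  next
    fix \<beta> k i assume "V k i \<noteq> V k (lookup \<beta> k)"
    then show "\<not> zero_divisor (V k (lookup \<beta> k) - V k i)"
      by (intro not_zero_divisor_diff[of _ k] V_in_S)
  next
    fix \<beta> assume \<beta>: "\<beta> \<in> ?A"
    let ?a = "\<lambda>k. V k (lookup \<beta> k)"
    have mult: "lookup (node_mult V \<beta>) k div \<psi> k (?a k) \<le> lookup \<beta> k div length (P k)"
      if "lookup \<beta> k < \<tau> k" for k
    proof -
      have "P k \<noteq> []"
        using that by (auto simp: \<tau>_def)
      moreover have "{i. i < lookup \<beta> k \<and> V k i = ?a k}
          = {i. i < lookup \<beta> k \<and> cycle_nth (P k) i = cycle_nth (P k) (lookup \<beta> k)}"
        using that by (auto simp: V_def)
      ultimately show ?thesis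
        using card_cycle_nth_div[OF P(1)] that by (simp add: node_mult_def V_def)
    qed
    \<comment> \<open>Inside the single round the quotient is 0; just after it the next node
      \<open>w k\<close> has not occurred before.\<close>
    have "lookup (node_mult V \<beta>) k div \<psi> k (?a k) = 0" if "k \<noteq> m" for k
    proof (cases "lookup \<beta> k < \<tau> k")
      case True
      then show ?thesis
        using mult[OF True] that by (simp add: \<tau>_def)
    next
      case False
      then have "lookup \<beta> k = \<tau> k"
        using \<beta> that by (auto intro: le_antisym)
      then have "{i. i < lookup \<beta> k \<and> V k i = ?a k} = {}"
        using in_P w_notin by (auto simp: V_def) metis
      then show ?thesis
        by (simp only: node_mult_def lookup_exp_of card.empty div_0)
    qed
    then have "(\<Sum>k\<in>UNIV. lookup (node_mult V \<beta>) k div \<psi> k (?a k))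
        = (\<Sum>k\<in>{m}. lookup (node_mult V \<beta>) k div \<psi> k (?a k))"
      by (intro sum.mono_neutral_right) auto
    also have "\<dots> \<le> lookup \<beta> m div length (P m)"
      using mult[of m] \<beta> by simp
    also have "\<dots> < t"
      using \<beta> by (intro less_mult_imp_div_less) (simp add: \<tau>_def)
    finally have "(\<Sum>k\<in>UNIV. lookup (node_mult V \<beta>) k div \<psi> k (?a k)) < t" .
    moreover have "?a m \<notin> E m"
      using \<beta> in_P[of "lookup \<beta> m" m] P(1)[of m] by (auto simp: V_def enum_roots_def)
    then have "?a \<in> Pi UNIV S - Pi UNIV E"
      using V_in_S by auto
    ultimately show "lookup (translate ?a (newton V ?c)) (node_mult V \<beta>) = 0"
      using vanish[unfolded vanishing_cond_iff, rule_format] by (simp flip: \<eta>)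
  qed (fact that)
  have "lookup (translate w \<zeta>) 0 \<noteq> 0"
    using nonzero by (auto simp: eval_mpoly_eq \<zeta> translate_mult lookup_mult_zero)
  then obtain \<beta> where \<beta>: "\<beta> \<in> keys c" "lookup (translate w (newton_basis ?W \<beta>)) 0 \<noteq> 0"
    unfolding c newton_def translate_sum translate_mult lookup_sum translate_Const lookup_Const_mult
    by (metis (no_types, lifting) mult_zero_right sum.neutral)
  \<comment> \<open>In these variables all nodes of the cofactor are \<open>w k\<close>, so any
    factor would make the basis element vanish at \<open>w\<close>.\<close>
  have "lookup \<beta> k = 0" if "k \<noteq> m" for k
  proof -
    have "card {i. i < lookup \<beta> k \<and> ?W k i = w k} \<le> lookup 0 k"
      using \<beta>(2) by (intro keys_translate_newton_basis) (simp add: in_keys_iff)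
    moreover have "{i. i < lookup \<beta> k \<and> ?W k i = w k} = {..<lookup \<beta> k}"
      using that by (auto simp: V_def \<tau>_def)
    ultimately have "card {..<lookup \<beta> k} \<le> lookup 0 k"
      by (simp only:)
    then show ?thesis by simp
  qed
  then have rest: "lookup (?\<epsilon> + \<beta>) k = \<tau> k" if "k \<noteq> m" for k
    using that by (simp add: lookup_add \<tau>_def)
  have "lookup ?c (?\<epsilon> + \<beta>) \<noteq> 0"
    using \<beta>(1) by (simp add: lookup_single_mult_add in_keys_iff)
  then have key: "?\<epsilon> + \<beta> \<in> keys ?c" and "?\<epsilon> + \<beta> \<notin> ?A"
    using zero by (auto simp: in_keys_iff)
  \<comment> \<open>The other coordinates equal \<open>\<tau> k\<close> and respect
    \<open>?A\<close>, so the bound at \<open>m\<close> is the one that fails.\<close>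
  then have "\<tau> m \<le> length (P m) + lookup \<beta> m"
    using rest by (auto simp: lookup_add not_less)
  moreover have "\<tau> m = (t - 1) * length (P m) + length (P m)"
    using t by (cases t) (simp_all add: \<tau>_def)
  moreover have "lookup \<beta> m \<le> weight \<beta>"
    unfolding weight_def by (rule member_le_sum) auto
  ultimately have "(t - 1) * length (P m) + (\<Sum>k\<in>UNIV. length (P k)) \<le> weight (?\<epsilon> + \<beta>)"
    by (simp add: weight_add)
  then have "ereal (real ((t - 1) * length (P m) + (\<Sum>k\<in>UNIV. length (P k))))
      \<le> ereal (real (weight (?\<epsilon> + \<beta>)))"
    by (simp only: ereal_less_eq of_nat_le_iff)
  also have "\<dots> \<le> total_deg \<eta>"
    using total_deg_newton_ge[OF key, of V] by (simp only: \<eta>[symmetric])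
  finally show ?thesis
    by (simp only: P(3))
qed

end

section \<open>Intersection of ideals, remainder and degree bound combined\<close>

theorem theorem5p3:
  fixes S E :: "'n::finite \<Rightarrow> 'r::comm_ring_1 set"
    and \<psi> :: "'n \<Rightarrow> 'r \<Rightarrow> nat"
    and t :: nat
    and f :: "('n, 'r) mpoly"
  assumes "\<And>k. finite (S k)"
    and "\<And>k. condition_D (S k)"
    and "\<And>k u. u \<in> S k \<Longrightarrow> \<psi> k u > 0"
    and "\<And>k. E k \<subseteq> S k"
  shows
    "(f \<in> (\<Inter>m. power_ideal t ((root_prod \<psi> S)(m := root_prod \<psi> (\<lambda>k. S k - E k) m)))
        \<longleftrightarrow> vanishing_cond S E \<psi> t f)
     \<and>
     (vanishing_cond S E \<psi> t f \<longrightarrow>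
        (\<exists>!\<eta>. f - \<eta> \<in> power_ideal t (root_prod \<psi> S)
              \<and> reduced t (\<lambda>k. \<Sum>u\<in>S k. \<psi> k u) \<eta>)
        \<and>
        (\<forall>\<eta>. f - \<eta> \<in> power_ideal t (root_prod \<psi> S)
              \<and> reduced t (\<lambda>k. \<Sum>u\<in>S k. \<psi> k u) \<eta> \<longrightarrow>
           Poly_Mapping.keys \<eta> \<subseteq> down_closure (Poly_Mapping.keys f)
           \<and> (\<Prod>k\<in>UNIV. root_prod \<psi> (\<lambda>i. S i - E i) k) dvd \<eta>
           \<and> (t \<ge> 1 \<and> (\<exists>w\<in>Pi UNIV S. eval_mpoly w f \<noteq> 0) \<longrightarrow>
                (\<forall>m. total_deg f \<ge> total_deg \<eta>
                   \<and> total_deg \<eta> \<ge> ereal (real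
                        ((t - 1) * (\<Sum>u\<in>S m - E m. \<psi> m u)
                          + (\<Sum>k\<in>UNIV. \<Sum>u\<in>S k - E k. \<psi> k u)))))))"
proof -
  interpret punctured_grid S \<psi> E
    by unfold_locales (fact assms)+
  have deg_eq: "(\<lambda>k. \<Sum>u\<in>S k. \<psi> k u) = deg"
    by (simp add: deg_def fun_eq_iff)
  \<comment> \<open>Each ideal of the intersection is the power ideal of a smaller grid, with
    \<open>S m\<close> cut down to \<open>S m - E m\<close>.\<close>
  let ?S = "\<lambda>m. S(m := S m - E m)"
  have part1: "f \<in> (\<Inter>m. power_ideal t ((root_prod \<psi> S)(m := root_prod \<psi> (\<lambda>k. S k - E k) m)))
      \<longleftrightarrow> vanishing_cond S E \<psi> t f"
  proof -
    have "grid (?S m) \<psi>" for m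
      using assms by unfold_locales (auto simp: condition_D_def split: if_splits)
    note mem_iff = grid.mem_power_ideal_iff[OF this]
    have "(root_prod \<psi> S)(m := root_prod \<psi> (\<lambda>k. S k - E k) m) = root_prod \<psi> (?S m)" for m
      by (auto simp: root_prod_def)
    \<comment> \<open>Intersecting the ideals amounts to imposing vanishing on the union of the
      smaller grids.\<close>
    moreover have "Pi UNIV S - Pi UNIV E = (\<Union>m. Pi UNIV (?S m))"
      by (auto simp: Pi_iff split: if_splits)
    ultimately show ?thesis
      by (simp add: mem_iff vanishing_cond_iff)
  qed
  have part2: "keys \<eta> \<subseteq> down_closure (keys f)
      \<and> (\<Prod>k\<in>UNIV. root_prod \<psi> (\<lambda>i. S i - E i) k) dvd \<eta>
      \<and> (t \<ge> 1 \<and> (\<exists>w\<in>Pi UNIV S. eval_mpoly w f \<noteq> 0) \<longrightarrow>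
           (\<forall>m. total_deg f \<ge> total_deg \<eta>
              \<and> total_deg \<eta> \<ge> ereal (real ((t - 1) * (\<Sum>u\<in>S m - E m. \<psi> m u)
                  + (\<Sum>k\<in>UNIV. \<Sum>u\<in>S k - E k. \<psi> k u)))))"
    if f: "vanishing_cond S E \<psi> t f"
      and mem: "f - \<eta> \<in> power_ideal t (root_prod \<psi> S)" and std: "keys \<eta> \<subseteq> standard t deg" for \<eta>
  proof -
    \<comment> \<open>By uniqueness \<eta> is the remainder already constructed, whose support is
      known.\<close>
    have keys: "keys \<eta> \<subseteq> down_closure (keys f)"
      using remainder_exists[of f t] remainder_unique[OF mem std] by blast
    \<comment> \<open>Since \<open>f - \<eta>\<close> is in the ideal, \<eta> inherits the vanishing
      condition from \<open>f\<close> and, for \<open>t \<ge> 1\<close>, its values on the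
      grid.\<close>
    have same: "lookup (translate a \<eta>) \<gamma> = lookup (translate a f) \<gamma>"
      if "a \<in> Pi UNIV S" "(\<Sum>i\<in>UNIV. lookup \<gamma> i div \<psi> i (a i)) < t" for a \<gamma>
      using power_ideal_vanishes[OF mem that] by (simp add: translate_diff lookup_minus)
    have \<eta>: "vanishing_cond S E \<psi> t \<eta>"
      using f same unfolding vanishing_cond_iff by auto
    note dvd = root_prod_dvd_remainder[OF \<eta> std]
    have deg_le: "total_deg \<eta> \<le> total_deg f"
      unfolding total_deg_def
    proof (rule SUP_mono)
      fix \<beta> assume "\<beta> \<in> keys \<eta>"
      then obtain \<alpha> where "\<alpha> \<in> keys f" "\<beta> \<preceq> \<alpha>"
        using subsetD[OF keys] unfolding down_closure_iff by blast
      then show "\<exists>\<alpha>\<in>keys f. ereal (real (weight \<beta>)) \<le> ereal (real (weight \<alpha>))"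
        using weight_mono by auto
    qed
    have "eval_mpoly w \<eta> = eval_mpoly w f" if "w \<in> Pi UNIV S" "t \<ge> 1" for w
      using same[OF that(1), of 0] that(2) by (simp add: eval_mpoly_eq)
    then show ?thesis
      using keys dvd deg_le total_deg_ge[OF \<eta> dvd] by (metis (no_types, lifting))
  qed
  have ex1: "\<exists>!\<eta>. f - \<eta> \<in> power_ideal t (root_prod \<psi> S) \<and> keys \<eta> \<subseteq> standard t deg"
    using remainder_exists[of f t] remainder_unique[of f] by blast
  show ?thesis
    unfolding deg_eq reduced_iff
  proof (rule conjI[OF part1], rule impI, rule conjI[OF ex1], rule allI, rule impI, elim conjE)
  qed (rule part2)
qed

end
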